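(* Let $(X,T)$ be a dynamical system with positive topological entropy. Then $(X,T)$ is $(r,s)$-Li-Yorke chaotic for any $r,s\in\mathbb{N}$.
   Context: A dynamical system $(X,T)$ is a compact metric space $(X,\rho)$ with a continuous map $T\colon X\to X$. $\mathbb{N}$ is the set of positive integers. For $r,s\in\mathbb{N}$, a pair $(x,y)\in X\times X$ is $(r,s)$-scrambled if $\liminf_{n\to\infty}\rho(T^{rn}x,T^{sn}y)=0$ and $\limsup_{n\to\infty}\rho(T^{rn}x,T^{sn}y)>0$. A subset $C\subset X$ is $(r,s)$-scrambled if any two distinct points $x,y\in C$ form an $(r,s)$-scrambled pair $(x,y)$. $(X,T)$ is $(r,s)$-Li-Yorke chaotic if there is an uncountable $(r,s)$-scrambled set in $X$. *)

theory Defs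
  imports "HOL-Analysis.Analysis"
begin

text \<open>
  The compact metric space is a compact subset \<open>X\<close> of a metric space type, with the
  restricted metric; \<open>X = UNIV\<close> is allowed. The values of \<open>T\<close> outside \<open>X\<close> play no role.
\<close>

definition dynamical_system :: "'a::metric_space set \<Rightarrow> ('a \<Rightarrow> 'a) \<Rightarrow> bool" where
  "dynamical_system X T \<longleftrightarrow> compact X \<and> continuous_on X T \<and> T ` X \<subseteq> X"

text \<open>Topological entropy via open covers (Adler, Konheim and McAndrew).\<close>

definition open_cover_of :: "'a::topological_space set \<Rightarrow> 'a set set \<Rightarrow> bool" where
  "open_cover_of X \<U> \<longleftrightarrow> (\<forall>U\<in>\<U>. openin (top_of_set X) U) \<and> \<Union>\<U> = X"

definition cover_number :: "'a set \<Rightarrow> 'a set set \<Rightarrow> nat" where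
  "cover_number X \<U> = (LEAST k. \<exists>\<V>. \<V> \<subseteq> \<U> \<and> finite \<V> \<and> X \<subseteq> \<Union>\<V> \<and> card \<V> = k)"

text \<open>
  The join of the covers \<open>T\<^sup>-\<^sup>i \<U>\<close> of \<open>X\<close> for \<open>0 \<le> i < n\<close>: its members are the
  intersections of the sets \<open>T\<^sup>-\<^sup>i (A i)\<close> over all choices of \<open>A 0, \<dots>, A (n - 1)\<close> in \<open>\<U>\<close>.
\<close>

definition iterated_join :: "'a set \<Rightarrow> ('a \<Rightarrow> 'a) \<Rightarrow> 'a set set \<Rightarrow> nat \<Rightarrow> 'a set set" where
  "iterated_join X T \<U> n = {{x \<in> X. \<forall>i<n. (T ^^ i) x \<in> A i} | A. \<forall>i<n. A i \<in> \<U>}"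

text \<open>
  The limit exists, since \<open>ln (cover_number X (iterated_join X T \<U> n))\<close> is nonnegative and
  subadditive in \<open>n\<close> for nonempty \<open>X\<close>, and is constantly \<open>ln 0 = 0\<close> for empty \<open>X\<close>.
\<close>

definition cover_entropy :: "'a set \<Rightarrow> ('a \<Rightarrow> 'a) \<Rightarrow> 'a set set \<Rightarrow> real" where
  "cover_entropy X T \<U> =
     lim (\<lambda>n. ln (real (cover_number X (iterated_join X T \<U> n))) / real n)"

definition topological_entropy :: "'a::metric_space set \<Rightarrow> ('a \<Rightarrow> 'a) \<Rightarrow> ereal" where
  "topological_entropy X T = (SUP \<U>\<in>{\<U>. open_cover_of X \<U>}. ereal (cover_entropy X T \<U>))"

definition scrambled_pair ::
    "nat \<Rightarrow> nat \<Rightarrow> ('a::metric_space \<Rightarrow> 'a) \<Rightarrow> 'a \<Rightarrow> 'a \<Rightarrow> bool" where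
  "scrambled_pair r s T x y \<longleftrightarrow>
     liminf (\<lambda>n. ereal (dist ((T ^^ (r * n)) x) ((T ^^ (s * n)) y))) = 0 \<and>
     limsup (\<lambda>n. ereal (dist ((T ^^ (r * n)) x) ((T ^^ (s * n)) y))) > 0"

text \<open>
  Both \<open>(x, y)\<close> and \<open>(y, x)\<close> are required to be scrambled; for \<open>r \<noteq> s\<close> these are
  different conditions.
\<close>

definition scrambled_set ::
    "nat \<Rightarrow> nat \<Rightarrow> 'a::metric_space set \<Rightarrow> ('a \<Rightarrow> 'a) \<Rightarrow> 'a set \<Rightarrow> bool" where
  "scrambled_set r s X T C \<longleftrightarrow>
     C \<subseteq> X \<and> (\<forall>x\<in>C. \<forall>y\<in>C. x \<noteq> y \<longrightarrow> scrambled_pair r s T x y)"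

definition Li_Yorke_chaotic ::
    "nat \<Rightarrow> nat \<Rightarrow> 'a::metric_space set \<Rightarrow> ('a \<Rightarrow> 'a) \<Rightarrow> bool" where
  "Li_Yorke_chaotic r s X T \<longleftrightarrow> (\<exists>C. scrambled_set r s X T C \<and> uncountable C)"

end

theory Submission
  imports Defs
begin

text \<open>
  Positive entropy yields disjoint closed sets \<open>A True\<close> and \<open>A False\<close> that are independent
  along sets of times \<open>J\<close> of positive density: every word on \<open>J\<close> is the itinerary of
  some point. Starting from this pair, cells indexed by the words of length \<open>m\<close> are refined,
  keeping all of them jointly independent along a set of positive density. Independence survives
  shrinking one cell to small diameter. By Roth's theorem for the configuration
  \<open>i, i + r n, i + s n\<close> the set of independence times returns to itself at the times \<open>r n\<close> and
  \<open>s n\<close>, so one may require all cells to enter one small cell at both times, or the cell of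
  \<open>w @ [a]\<close> to enter \<open>A a\<close> at both times. Points with codes that differ infinitely often are
  then scrambled.
\<close>

subsection \<open>Roth's theorem for the configuration \<open>i, i + r n, i + s n\<close>\<close>

text \<open>A pair compares \<open>x\<close> at time \<open>r n\<close> with \<open>y\<close> at
  time \<open>s n\<close>, and scrambling is demanded in both orders. Each point therefore has to be
  steered at two later times at once; together with the present time this makes a three-term
  configuration, and every construction treats the times \<open>r n\<close> and \<open>s n\<close>
  alike. The obstacle is to make a cell small without losing independence, since a word may need
  different pieces of the cell at different times. Covering numbers get around this. The covering
  number of a family is at most the product of those obtained by replacing a cell with each of
  finitely many pieces, so some piece keeps exponential growth. A count of shattered sets in the
  style of Sauer and Shelah turns exponential growth back into independence, at the price of keeping
  the cells disjoint. The proof switches between the two forms, \<open>exp_cover\<close> and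
  \<open>dense_indep\<close>, at every level. Positive density of the times, not merely infinitely
  many of them, is what makes Roth's theorem applicable again at the next level.\<close>

definition config_free :: "nat \<Rightarrow> nat \<Rightarrow> nat set \<Rightarrow> bool" where
  "config_free r s A \<longleftrightarrow> \<not> (\<exists>i n. n \<ge> 1 \<and> i \<in> A \<and> i + r * n \<in> A \<and> i + s * n \<in> A)"

text \<open>The analogue for this configuration of the extremal function \<open>r_3(n)\<close> in
  Roth's theorem on three-term progressions.\<close>

definition max_config_free :: "nat \<Rightarrow> nat \<Rightarrow> nat \<Rightarrow> nat" where
  "max_config_free r s n = Max (card ` {A. A \<subseteq> {..<n} \<and> config_free r s A})"

lemma config_free_card_le:
  assumes "A \<subseteq> {..<n}" "config_free r s A"
  shows "card A \<le> max_config_free r s n"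
  unfolding max_config_free_def
proof (rule Max_ge)
  show "finite (card ` {A. A \<subseteq> {..<n} \<and> config_free r s A})"
    by (rule finite_imageI, rule finite_subset[of _ "Pow {..<n}"]) auto
qed (use assms in auto)

lemma max_config_free_attained:
  "\<exists>A \<subseteq> {..<n}. config_free r s A \<and> card A = max_config_free r s n"
proof -
  have "max_config_free r s n \<in> card ` {A. A \<subseteq> {..<n} \<and> config_free r s A}"
    unfolding max_config_free_def
  proof (rule Max_in)
    show "finite (card ` {A. A \<subseteq> {..<n} \<and> config_free r s A})"
      by (rule finite_imageI, rule finite_subset[of _ "Pow {..<n}"]) auto
    show "card ` {A. A \<subseteq> {..<n} \<and> config_free r s A} \<noteq> {}"
      by (auto simp: config_free_def intro!: exI[of _ "{}"])
  qed
  then show ?thesis by auto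
qed

text \<open>The configuration is affine invariant: one with step \<open>n\<close> in the indices
  \<open>j\<close> becomes one with step \<open>n * e\<close> in \<open>A\<close>. So the bound for
  intervals holds along every progression.\<close>

lemma config_free_card_progression_le:
  assumes "config_free r s A" and "e \<ge> 1"
  shows "card {j. j < l \<and> x + j * e \<in> A} \<le> max_config_free r s l"
proof (rule config_free_card_le)
  show "config_free r s {j. j < l \<and> x + j * e \<in> A}"
    unfolding config_free_def
  proof (intro notI, elim exE conjE)
    fix i n :: nat
    assume n: "1 \<le> n" and "i \<in> {j. j < l \<and> x + j * e \<in> A}"
      "i + r * n \<in> {j. j < l \<and> x + j * e \<in> A}" "i + s * n \<in> {j. j < l \<and> x + j * e \<in> A}"
    then have "x + i * e \<in> A" "(x + i * e) + r * (n * e) \<in> A" "(x + i * e) + s * (n * e) \<in> A"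
      by (auto simp: algebra_simps)
    moreover have "n * e \<ge> 1" using n assms(2) by simp
    ultimately show False using assms(1) unfolding config_free_def by blast
  qed
qed auto

section \<open>Hilbert cubes in dense sets of integers\<close>

fun cube_in :: "nat set \<Rightarrow> nat \<Rightarrow> nat list \<Rightarrow> bool" where
  "cube_in B m [] \<longleftrightarrow> m \<in> B"
| "cube_in B m (d # ds) \<longleftrightarrow> cube_in B m ds \<and> cube_in B (m + d) ds"

lemma cube_in_base: "cube_in B m ds \<Longrightarrow> m \<in> B"
  by (induction ds arbitrary: m) auto

lemma cube_in_shift:
  "cube_in {x \<in> B. x + d \<in> B} m ds \<Longrightarrow> cube_in B m ds \<and> cube_in B (m + d) ds"
proof (induction ds arbitrary: m)
  case (Cons a ds)
  then show ?case using Cons.IH[of m] Cons.IH[of "m + a"] by (auto simp: ac_simps)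
qed auto

text \<open>A Bonferroni inequality, by induction: the new set meets the earlier union in at most
  the sum of its pairwise intersections.\<close>

lemma sum_card_le_card_UN_plus_pairs:
  fixes n :: nat
  assumes "\<forall>i<n. finite (S i)"
  shows "(\<Sum>i<n. card (S i)) \<le> card (\<Union>i<n. S i) + (\<Sum>j<n. \<Sum>i<j. card (S i \<inter> S j))"
  using assms
proof (induction n)
  case (Suc n)
  have fin: "finite (\<Union>i<n. S i)" "finite (S n)" using Suc.prems by auto
  have un: "(\<Union>i<Suc n. S i) = (\<Union>i<n. S i) \<union> S n" by (auto simp: less_Suc_eq)
  have "(\<Union>i<n. S i) \<inter> S n = (\<Union>i<n. S i \<inter> S n)" by auto
  then have "card ((\<Union>i<n. S i) \<inter> S n) \<le> (\<Sum>i<n. card (S i \<inter> S n))"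
    using card_UN_le[of "{..<n}" "\<lambda>i. S i \<inter> S n"] by simp
  moreover have "(\<Sum>i<n. card (S i)) \<le> card (\<Union>i<n. S i) + (\<Sum>j<n. \<Sum>i<j. card (S i \<inter> S j))"
    by (rule Suc.IH) (use Suc.prems in auto)
  ultimately show ?case
    using card_Un_Int[OF fin] unfolding un sum.lessThan_Suc by linarith
qed simp

text \<open>Take the translates of \<open>B\<close> by \<open>0, ..., t - 1\<close> with
  \<open>t > 3 / \<delta>\<close>. Their sizes add up to at least \<open>3 N\<close>, while they lie
  in an interval of length \<open>N + t \<le> 2 N\<close>. Hence the pairwise overlaps add up to at
  least \<open>N\<close>, and one of the fewer than \<open>t * t\<close> pairs overlaps in
  \<open>N / (t * t)\<close> points.\<close>

lemma dense_return:
  fixes \<delta> :: real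
  assumes "\<delta> > 0"
  shows "\<exists>D \<delta>'. \<delta>' > 0 \<and> (\<forall>N B. N \<ge> D \<longrightarrow> B \<subseteq> {..<N} \<longrightarrow> \<delta> * real N \<le> real (card B) \<longrightarrow>
     (\<exists>d. 1 \<le> d \<and> d \<le> D \<and> \<delta>' * real N \<le> real (card {x \<in> B. x + d \<in> B})))"
proof -
  obtain t :: nat where t: "real t > 3 / \<delta>" using reals_Archimedean2 by blast
  moreover have "3 / \<delta> > 0" using assms by simp
  ultimately have tpos: "t > 0" by linarith
  have t3: "real t * \<delta> > 3" using t assms by (simp add: field_simps)
  show ?thesis
  proof (rule exI[of _ t], rule exI[of _ "1 / (real t * real t)"], rule conjI, goal_cases)
    case 1
    show "1 / (real t * real t) > 0" using tpos by simp
  next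
    case 2
    show ?case
    proof (intro allI impI)
      fix N B assume N: "N \<ge> t" and B: "B \<subseteq> {..<N}" and cB: "\<delta> * real N \<le> real (card B)"
      have finB: "finite B" using B finite_subset by blast
      define S where "S i = (\<lambda>b. b + i) ` B" for i
      have cS: "card (S i) = card B" for i unfolding S_def by (rule card_image) auto
      have finS: "finite (S i)" for i using finB by (simp add: S_def)
      have "(\<Union>i<t. S i) \<subseteq> {..<N + t}" using B by (force simp: S_def)
      then have "card (\<Union>i<t. S i) \<le> N + t" by (metis card_lessThan card_mono finite_lessThan)
      with sum_card_le_card_UN_plus_pairs[of t S]
      have "t * card B \<le> N + t + (\<Sum>j<t. \<Sum>i<j. card (S i \<inter> S j))"
        using finS by (simp add: cS)
      then have 1: "real t * real (card B) \<le> real N + real t + real (\<Sum>j<t. \<Sum>i<j. card (S i \<inter> S j))"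
        unfolding of_nat_add[symmetric] of_nat_mult[symmetric] of_nat_le_iff .
      have 2: "real t * real (card B) \<ge> 3 * real N"
      proof -
        have "3 * real N \<le> (real t * \<delta>) * real N" using t3 by (intro mult_right_mono) auto
        also have "\<dots> = real t * (\<delta> * real N)" by simp
        also have "\<dots> \<le> real t * real (card B)" using cB by (intro mult_left_mono) auto
        finally show ?thesis .
      qed
      have 3: "real (\<Sum>j<t. \<Sum>i<j. card (S i \<inter> S j)) \<ge> real N" using 1 2 N by linarith
      have "\<exists>j<t. \<exists>i<j. 1 / (real t * real t) * real N \<le> real (card (S i \<inter> S j))"
      proof (rule ccontr)
        assume "\<not> ?thesis"
        then have less: "real (card (S i \<inter> S j)) < 1 / (real t * real t) * real N" if "j < t" "i < j" for i j
          using that by (meson not_less)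
        have Npos: "real N > 0" using N tpos by simp
        have "(\<Sum>j<t. \<Sum>i<j. real (card (S i \<inter> S j))) < (\<Sum>j<t. real t * (1 / (real t * real t) * real N))"
        proof (rule sum_strict_mono)
          fix j assume j: "j \<in> {..<t}"
          have "(\<Sum>i<j. real (card (S i \<inter> S j))) \<le> (\<Sum>i<j. 1 / (real t * real t) * real N)"
            using less j by (intro sum_mono) (auto intro: less_imp_le)
          also have "\<dots> = real j * (1 / (real t * real t) * real N)" by simp
          also have "\<dots> < real t * (1 / (real t * real t) * real N)"
            using j Npos tpos by (intro mult_strict_right_mono) auto
          finally show "(\<Sum>i<j. real (card (S i \<inter> S j))) < real t * (1 / (real t * real t) * real N)" .
        qed (use tpos in auto)
        also have "\<dots> = real N" using tpos by simp
        finally show False using 3 by simp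
      qed
      then obtain i j where ij: "j < t" "i < j" and c: "1 / (real t * real t) * real N \<le> real (card (S i \<inter> S j))" by blast
      have "S i \<inter> S j \<subseteq> (\<lambda>x. x + j) ` {x \<in> B. x + (j - i) \<in> B}"
      proof
        fix y assume "y \<in> S i \<inter> S j"
        then obtain a b where "a \<in> B" "b \<in> B" "y = a + i" "y = b + j" by (auto simp: S_def)
        then have "b + (j - i) = a" using ij by simp
        then show "y \<in> (\<lambda>x. x + j) ` {x \<in> B. x + (j - i) \<in> B}" using \<open>a \<in> B\<close> \<open>b \<in> B\<close> \<open>y = b + j\<close> by auto
      qed
      then have "card (S i \<inter> S j) \<le> card {x \<in> B. x + (j - i) \<in> B}"
        using finB by (intro surj_card_le) auto
      then show "\<exists>d. 1 \<le> d \<and> d \<le> t \<and> 1 / (real t * real t) * real N \<le> real (card {x \<in> B. x + d \<in> B})"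
        using ij c by (intro exI[of _ "j - i"]) auto
    qed
  qed
qed

text \<open>Hilbert's cube lemma: \<open>dense_return\<close> is iterated on the set of
  \<open>x\<close> with both \<open>x\<close> and \<open>x + d\<close> in \<open>B\<close>, which is
  still dense. The bound \<open>D\<close> depends only on \<open>\<delta>\<close> and
  \<open>k\<close>, so the differences stay small against a later choice of
  \<open>N\<close>.\<close>

lemma dense_cube:
  fixes \<delta> :: real
  assumes "\<delta> > 0"
  shows "\<exists>D. \<forall>N B. N \<ge> D \<longrightarrow> B \<subseteq> {..<N} \<longrightarrow> \<delta> * real N \<le> real (card B) \<longrightarrow>
     (\<exists>m ds. length ds = k \<and> (\<forall>d\<in>set ds. 1 \<le> d \<and> d \<le> D) \<and> cube_in B m ds)"
  using assms
proof (induction k arbitrary: \<delta>)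
  case (0 \<delta>)
  show ?case
  proof (rule exI[of _ 1], intro allI impI)
    fix N :: nat and B :: "nat set" assume *: "1 \<le> N" "B \<subseteq> {..<N}" "\<delta> * real N \<le> real (card B)"
    have "0 < \<delta> * real N" using *(1) 0 by simp
    then have "card B > 0" using *(3) by linarith
    then obtain m where "m \<in> B" by (metis card_gt_0_iff ex_in_conv)
    then show "\<exists>m ds. length ds = 0 \<and> (\<forall>d\<in>set ds. 1 \<le> d \<and> d \<le> 1) \<and> cube_in B m ds"
      by (intro exI[of _ m] exI[of _ "[]"]) simp
  qed
next
  case (Suc k \<delta>)
  obtain D1 \<delta>' where D1: "\<delta>' > 0"
    "\<And>N B. N \<ge> D1 \<Longrightarrow> B \<subseteq> {..<N} \<Longrightarrow> \<delta> * real N \<le> real (card B) \<Longrightarrow>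
       \<exists>d. 1 \<le> d \<and> d \<le> D1 \<and> \<delta>' * real N \<le> real (card {x \<in> B. x + d \<in> B})"
    using dense_return[OF Suc.prems] by metis
  obtain D2 where D2: "\<And>N B. N \<ge> D2 \<Longrightarrow> B \<subseteq> {..<N} \<Longrightarrow> \<delta>' * real N \<le> real (card B) \<Longrightarrow>
     \<exists>m ds. length ds = k \<and> (\<forall>d\<in>set ds. 1 \<le> d \<and> d \<le> D2) \<and> cube_in B m ds"
    using Suc.IH[OF D1(1)] by metis
  show ?case
  proof (rule exI[of _ "max D1 D2"], intro allI impI)
    fix N B assume *: "N \<ge> max D1 D2" "B \<subseteq> {..<N}" "\<delta> * real N \<le> real (card B)"
    then obtain d where d: "1 \<le> d" "d \<le> D1" "\<delta>' * real N \<le> real (card {x \<in> B. x + d \<in> B})"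
      using D1(2)[of N B] by auto
    then obtain m ds where "length ds = k" "\<forall>d\<in>set ds. 1 \<le> d \<and> d \<le> D2" "cube_in {x \<in> B. x + d \<in> B} m ds"
      using D2[of N "{x \<in> B. x + d \<in> B}"] * by auto
    then have "length (d # ds) = Suc k \<and> (\<forall>d'\<in>set (d # ds). 1 \<le> d' \<and> d' \<le> max D1 D2) \<and> cube_in B m (d # ds)"
      using d(1,2) cube_in_shift[of B d m ds] by auto
    then show "\<exists>m ds. length ds = Suc k \<and> (\<forall>d\<in>set ds. 1 \<le> d \<and> d \<le> max D1 D2) \<and> cube_in B m ds"
      by blast
  qed
qed

text \<open>Replace \<open>M\<close> by its union with \<open>M + d\<close>, one difference of the
  cube after another. As long as almost invariance fails, \<open>F M\<close> gains more than
  \<open>g\<close> elements each time, and after \<open>length ds\<close> gains it would outgrow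
  \<open>{..<N}\<close>. The cube condition keeps all these sets inside \<open>B\<close>.\<close>

lemma cube_almost_invariant:
  fixes F :: "nat set \<Rightarrow> nat set"
  assumes F_Un: "\<And>M M'. F (M \<union> M') = F M \<union> F M'"
    and F_bound: "\<And>M. M \<subseteq> B \<Longrightarrow> F M \<subseteq> {..<N}"
  shows "M \<noteq> {} \<Longrightarrow> (\<And>m. m \<in> M \<Longrightarrow> cube_in B m ds) \<Longrightarrow> card (F M) + length ds * Suc g > N \<Longrightarrow>
    \<exists>M' d. d \<in> set ds \<and> M \<subseteq> M' \<and> M' \<subseteq> B \<and> card (F ((\<lambda>m. m + d) ` M') - F M') \<le> g"
proof (induction ds arbitrary: M)
  case Nil
  then have "M \<subseteq> B" by auto
  then have "card (F M) \<le> N" using F_bound by (metis card_lessThan card_mono finite_lessThan)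
  with Nil show ?case by simp
next
  case (Cons d ds)
  let ?M' = "(\<lambda>m. m + d) ` M"
  have sub: "M \<subseteq> B" "?M' \<subseteq> B" using Cons.prems(2) cube_in_base by force+
  show ?case
  proof (cases "card (F ?M' - F M) \<le> g")
    case True
    then show ?thesis using sub by (intro exI[of _ M] exI[of _ d]) auto
  next
    case False
    have fin: "finite (F M)" "finite (F ?M')"
      using F_bound[OF sub(1)] F_bound[OF sub(2)] by (auto intro: finite_subset)
    have "card (F (M \<union> ?M')) = card (F M \<union> (F ?M' - F M))" unfolding F_Un by (simp only: Un_Diff_cancel)
    also have "\<dots> = card (F M) + card (F ?M' - F M)"
      using fin by (intro card_Un_disjoint) auto
    finally have "card (F (M \<union> ?M')) \<ge> card (F M) + Suc g" using False by linarith
    moreover have "length (d # ds) * Suc g = Suc g + length ds * Suc g" by simp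
    ultimately have big: "card (F (M \<union> ?M')) + length ds * Suc g > N" using Cons.prems(3) by linarith
    have "\<exists>M'' d. d \<in> set ds \<and> M \<union> ?M' \<subseteq> M'' \<and> M'' \<subseteq> B \<and> card (F ((\<lambda>m. m + d) ` M'') - F M'') \<le> g"
    proof (rule Cons.IH)
      show "M \<union> ?M' \<noteq> {}" using Cons.prems(1) by blast
      show "cube_in B m ds" if "m \<in> M \<union> ?M'" for m using that Cons.prems(2) by auto
    qed (rule big)
    then show ?thesis by (meson Un_subset_iff list.set_intros(2))
  qed
qed

text \<open>
  Count the pairs of a point of \<open>A\<close> and a progression of length \<open>l\<close> and difference \<open>e\<close>
  through it: progressions starting in \<open>F\<close> mostly stay in \<open>F\<close> and so miss \<open>A\<close>.
\<close>

lemma card_avoiding_almost_invariant: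
  assumes A: "A \<subseteq> {..<N}" "config_free r s A" and F: "F \<subseteq> {..<N}" "F \<inter> A = {}"
    and e: "e \<ge> 1" and g: "card ((\<lambda>f. f + e) ` F - F) \<le> g"
  shows "l * card A \<le> l * (l * e) + max_config_free r s l * (N - card F + l * g)"
proof -
  let ?P = "SIGMA x:{..<N}. {j. j < l \<and> x + j * e \<in> A}"
  have finA: "finite A" and finF: "finite F" using A F finite_subset by blast+
  \<comment> \<open>Elements of \<open>A\<close> below \<open>l * e\<close> are left out, as the
    start \<open>a - j * e\<close> could be truncated at 0; this costs at most \<open>l * e\<close>
    elements.\<close>
  let ?Q = "(A - {..<l * e}) \<times> {..<l}"
  have sub: "a - j * e < N \<and> a - j * e + j * e \<in> A" if "a \<in> A" "l * e \<le> a" "j < l" for a j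
  proof -
    have "j * e \<le> l * e" using that by simp
    then have "j * e \<le> a" using that by linarith
    moreover have "a < N" using that A by auto
    ultimately show ?thesis using that by auto
  qed
  have inj: "a = b" if "l * e \<le> a" "l * e \<le> b" "j < l" "a - j * e = b - j * e" for a b j
  proof -
    have "j * e \<le> l * e" using that by simp
    then show ?thesis using that by linarith
  qed
  have "card ?Q \<le> card ?P"
  proof (rule card_inj_on_le)
    show "inj_on (\<lambda>(a, j). (a - j * e, j)) ?Q"
      using inj by (auto simp: inj_on_def not_less)
    show "(\<lambda>(a, j). (a - j * e, j)) ` ?Q \<subseteq> ?P"
      using sub by (auto simp: not_less)
  qed simp
  moreover have "card ?Q = card (A - {..<l * e}) * l"
    by (simp only: card_cartesian_product card_lessThan)
  moreover have "card A - l * e \<le> card (A - {..<l * e})"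
    using diff_card_le_card_Diff[of "{..<l * e}" A] by simp
  then have "l * card A \<le> l * (l * e + card (A - {..<l * e}))" by (intro mult_left_mono) auto
  ultimately have lower: "l * card A \<le> l * (l * e) + card ?P"
    by (simp add: distrib_left mult.commute)
  let ?G = "(\<lambda>f. f + e) ` F - F"
  \<comment> \<open>The starts whose progression arrives at a point of \<open>?G\<close> within
    \<open>l\<close> steps. A progression that starts in \<open>F\<close> and never arrives there
    stays in \<open>F\<close>, hence misses \<open>A\<close>.\<close>
  let ?bad = "\<Union>j<l. {x. x + Suc j * e \<in> ?G}"
  have sub: "{x \<in> {..<N}. {j. j < l \<and> x + j * e \<in> A} \<noteq> {}} \<subseteq> ({..<N} - F) \<union> ?bad"
  proof
    fix x assume "x \<in> {x \<in> {..<N}. {j. j < l \<and> x + j * e \<in> A} \<noteq> {}}"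
    then obtain j where *: "x < N" "j < l" "x + j * e \<in> A" by auto
    have "x \<in> ?bad" if xF: "x \<in> F"
    proof (rule ccontr)
      assume nb: "x \<notin> ?bad"
      have "i < l \<Longrightarrow> x + i * e \<in> F" for i
      proof (induction i)
        case (Suc i)
        then have "x + Suc i * e \<in> (\<lambda>f. f + e) ` F" by (intro image_eqI[of _ _ "x + i * e"]) auto
        moreover have "x + Suc i * e \<notin> ?G"
        proof
          assume "x + Suc i * e \<in> ?G"
          then have "x \<in> ?bad" using Suc.prems by (intro UN_I[of i]) simp_all
          then show False using nb by contradiction
        qed
        ultimately show ?case by blast
      qed (use xF in simp)
      then show False using * F(2) by blast
    qed
    then show "x \<in> ({..<N} - F) \<union> ?bad" using * by blast
  qed
  have "card ?bad \<le> (\<Sum>j<l. card {x. x + Suc j * e \<in> ?G})" by (rule card_UN_le) auto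
  also have "\<dots> \<le> (\<Sum>j<l. g)"
  proof (rule sum_mono)
    fix j
    have "card {x. x + Suc j * e \<in> ?G} \<le> card ?G"
      by (rule card_inj_on_le[of "\<lambda>x. x + Suc j * e"]) (use finF in \<open>auto simp: inj_on_def\<close>)
    then show "card {x. x + Suc j * e \<in> ?G} \<le> g" using g by simp
  qed
  finally have bad: "card ?bad \<le> l * g" by simp
  have finbad: "finite ?bad"
  proof (intro finite_UN_I)
    fix j
    show "finite {x. x + Suc j * e \<in> ?G}"
      by (rule finite_imageD[of "\<lambda>x. x + Suc j * e"], rule finite_subset[of _ ?G])
         (use finF in \<open>auto simp: inj_on_def\<close>)
  qed simp
  have "card {x \<in> {..<N}. {j. j < l \<and> x + j * e \<in> A} \<noteq> {}} \<le> card (({..<N} - F) \<union> ?bad)"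
    by (intro card_mono sub) (use finbad in auto)
  also have "\<dots> \<le> card ({..<N} - F) + card ?bad" by (rule card_Un_le)
  also have "card ({..<N} - F) = N - card F" using F finF by (simp add: card_Diff_subset)
  finally have meet: "card {x \<in> {..<N}. {j. j < l \<and> x + j * e \<in> A} \<noteq> {}} \<le> N - card F + l * g"
    using bad by linarith
  have "card ?P = (\<Sum>x<N. card {j. j < l \<and> x + j * e \<in> A})" by (simp add: card_SigmaI)
  also have "\<dots> = (\<Sum>x\<in>{x \<in> {..<N}. {j. j < l \<and> x + j * e \<in> A} \<noteq> {}}. card {j. j < l \<and> x + j * e \<in> A})"
    by (rule sum.mono_neutral_right) auto
  also have "\<dots> \<le> (\<Sum>x\<in>{x \<in> {..<N}. {j. j < l \<and> x + j * e \<in> A} \<noteq> {}}. max_config_free r s l)"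
    by (intro sum_mono config_free_card_progression_le A e)
  also have "\<dots> \<le> max_config_free r s l * (N - card F + l * g)" using meet by simp
  finally show ?thesis using lower by linarith
qed

text \<open>Cut the progression into \<open>M\<close> blocks of length \<open>l\<close>; each block
  is again a progression with difference \<open>e\<close>.\<close>

lemma config_free_card_long_progression_le:
  assumes "config_free r s A" and "e \<ge> 1"
  shows "card {j. j < M * l \<and> x + j * e \<in> A} \<le> M * max_config_free r s l"
proof (induction M)
  case (Suc M)
  have "{j. j < Suc M * l \<and> x + j * e \<in> A} \<subseteq>
      {j. j < M * l \<and> x + j * e \<in> A} \<union> (\<lambda>j. M * l + j) ` {j. j < l \<and> (x + M * l * e) + j * e \<in> A}"
  proof
    fix j assume j: "j \<in> {j. j < Suc M * l \<and> x + j * e \<in> A}"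
    show "j \<in> {j. j < M * l \<and> x + j * e \<in> A} \<union> (\<lambda>j. M * l + j) ` {j. j < l \<and> (x + M * l * e) + j * e \<in> A}"
    proof (cases "j < M * l")
      case False
      then have "j = M * l + (j - M * l)" by simp
      moreover from this have "x + j * e = (x + M * l * e) + (j - M * l) * e"
        by (metis add.assoc distrib_right)
      ultimately show ?thesis using j False
        by (intro UnI2 image_eqI[of _ _ "j - M * l"]) (auto simp: add.assoc)
    qed (use j in simp)
  qed
  then have "card {j. j < Suc M * l \<and> x + j * e \<in> A} \<le>
      card ({j. j < M * l \<and> x + j * e \<in> A} \<union> (\<lambda>j. M * l + j) ` {j. j < l \<and> (x + M * l * e) + j * e \<in> A})"
    by (intro card_mono) auto
  also have "\<dots> \<le> card {j. j < M * l \<and> x + j * e \<in> A} +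
      card ((\<lambda>j. M * l + j) ` {j. j < l \<and> (x + M * l * e) + j * e \<in> A})"
    by (rule card_Un_le)
  also have "card ((\<lambda>j. M * l + j) ` {j. j < l \<and> (x + M * l * e) + j * e \<in> A})
      \<le> card {j. j < l \<and> (x + M * l * e) + j * e \<in> A}"
    by (rule card_image_le) auto
  also have "\<dots> \<le> max_config_free r s l"
    by (rule config_free_card_progression_le[OF assms])
  finally show ?case using Suc by simp
qed simp

text \<open>
  Suppose the limiting density \<open>\<alpha>\<close> of large configuration-free sets \<open>A\<close> is positive. Elements
  \<open>r j\<close> and \<open>r (K' + m)\<close> of \<open>A\<close> forbid the third point \<open>r j + s (K' + m - j)\<close>. Letting \<open>m\<close>
  run through a Hilbert cube with small differences makes the forbidden set \<open>F M\<close> almost invariant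
  under a small shift, so that the complement of \<open>F M\<close> consists mostly of long progressions.
  There \<open>A\<close> has density at most about \<open>\<alpha>\<close>, which is too little as \<open>F M\<close> has positive density.
\<close>

lemma max_config_free_sublinear:
  fixes \<delta> :: real
  assumes r: "1 \<le> r" and rs: "r < s" and \<delta>: "0 < \<delta>"
  shows "\<exists>n\<ge>1. real (max_config_free r s n) < \<delta> * real n"
proof (rule ccontr)
  let ?R = "max_config_free r s"
  assume "\<not> ?thesis"
  then have neg: "\<delta> * real n \<le> real (?R n)" if "n \<ge> 1" for n using that not_less by blast
  \<comment> \<open>By subadditivity this infimum is the limit of the ratios. Two facts are drawn
    from it: \<open>\<alpha> * n\<close> is a lower bound for every \<open>n\<close>, and it is
    nearly attained at some \<open>l\<close>.\<close>
  define \<alpha> where "\<alpha> = (INF n\<in>{1..}. real (?R n) / real n)"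
  have bdd: "bdd_below ((\<lambda>n. real (?R n) / real n) ` {1..})"
    by (rule bdd_belowI[of _ 0]) auto
  have \<alpha>_le: "\<alpha> * real n \<le> real (?R n)" if "n \<ge> 1" for n
  proof -
    have "\<alpha> \<le> real (?R n) / real n" unfolding \<alpha>_def by (rule cINF_lower[OF bdd]) (use that in auto)
    then show ?thesis using that by (simp add: field_simps)
  qed
  have "\<delta> \<le> \<alpha>" unfolding \<alpha>_def
  proof (rule cINF_greatest)
    fix n :: nat assume "n \<in> {1..}"
    then show "\<delta> \<le> real (?R n) / real n" using neg[of n] by (simp add: field_simps)
  qed auto
  then have \<alpha>_pos: "\<alpha> > 0" using \<delta> by simp
  have "?R 1 \<le> 1"
  proof -
    obtain A where "A \<subseteq> {..<1::nat}" "card A = ?R 1"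
      using max_config_free_attained[of 1 r s] by blast
    then show ?thesis using card_mono[of "{..<1::nat}" A] by simp
  qed
  then have \<alpha>1: "\<alpha> \<le> 1" using \<alpha>_le[of 1] by simp
  have near: "\<exists>l\<ge>1. real (?R l) \<le> (\<alpha> + \<epsilon>) * real l" if "\<epsilon> > 0" for \<epsilon>
  proof -
    have "\<alpha> < \<alpha> + \<epsilon>" using that by simp
    then have "\<exists>l\<in>{1..}. real (?R l) / real l < \<alpha> + \<epsilon>"
      using cINF_less_iff[OF _ bdd, of "\<alpha> + \<epsilon>"] unfolding \<alpha>_def[symmetric] by blast
    then obtain l where "l \<in> {1..}" "real (?R l) / real l < \<alpha> + \<epsilon>" by blast
    then show ?thesis by (intro exI[of _ l]) (auto simp: field_simps)
  qed
  have s: "s \<ge> 1" using rs by simp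
  \<comment> \<open>With \<open>N = 3 * s * r * K'\<close> below,
    \<open>c * N = \<alpha> / 2 * K'\<close>, the guaranteed size of the forbidden set. Losing that
    fraction of the room costs \<open>A\<close> about \<open>\<alpha> * c * N\<close> elements. The
    excess \<open>\<epsilon>\<close>, the error from imperfect invariance and the boundary error are
    each arranged to give back at most a quarter of this.\<close>
  define c where "c = \<alpha> / (6 * real r * real s)"
  have c_pos: "c > 0" using \<alpha>_pos r s by (simp add: c_def)
  define \<epsilon> where "\<epsilon> = \<alpha> * c / 4"
  have \<epsilon>_pos: "\<epsilon> > 0" using \<alpha>_pos c_pos by (simp add: \<epsilon>_def)
  have c1: "c \<le> 1"
  proof -
    have "1 \<le> real r * real s" using r s by (metis mult_le_mono nat_mult_1 of_nat_1 of_nat_le_iff of_nat_mult)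
    then show ?thesis unfolding c_def using \<alpha>1 by (simp add: field_simps)
  qed
  have \<epsilon>1: "\<epsilon> \<le> 1"
    using mult_le_one[OF \<alpha>1 _ c1] c_pos \<alpha>_pos unfolding \<epsilon>_def by linarith
  obtain l where l: "l \<ge> 1" "real (?R l) \<le> (\<alpha> + \<epsilon>) * real l" using near[OF \<epsilon>_pos] by blast
  \<comment> \<open>A cube of dimension \<open>k\<close> gives invariance up to
    \<open>g \<le> N / k\<close>. This error enters multiplied by \<open>l\<close> and by
    \<open>\<alpha> + \<epsilon> \<le> 2\<close>, hence the factor 8.\<close>
  obtain k where k: "real k \<ge> 8 * real l / (\<alpha> * c)" using real_arch_simple by blast
  have k_pos: "k > 0"
  proof -
    have "8 * real l / (\<alpha> * c) > 0" using l \<alpha>_pos c_pos by simp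
    then show ?thesis using k by linarith
  qed
  have "\<alpha> / 2 > 0" using \<alpha>_pos by simp
  from dense_cube[OF this, of k]
  obtain D where D: "\<forall>N B. N \<ge> D \<longrightarrow> B \<subseteq> {..<N} \<longrightarrow> \<alpha> / 2 * real N \<le> real (card B) \<longrightarrow>
     (\<exists>m ds. length ds = k \<and> (\<forall>d\<in>set ds. 1 \<le> d \<and> d \<le> D) \<and> cube_in B m ds)" by blast
  \<comment> \<open>\<open>M\<close> is chosen after \<open>D\<close>: it makes \<open>N\<close>
    large enough for the cube lemma and for the boundary error \<open>l * s * D\<close> to be
    negligible.\<close>
  obtain M where M: "real M \<ge> 4 * real l * real s * real D / (\<alpha> * c) + real D + 1" using real_arch_simple by blast
  have "4 * real l * real s * real D / (\<alpha> * c) \<ge> 0" using \<alpha>_pos c_pos by simp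
  then have MD: "M \<ge> D" "M \<ge> 1" and M4: "4 * real l * real s * real D / (\<alpha> * c) \<le> real M" using M by linarith+
  define K' where "K' = M * l"
  define K where "K = r * K'"
  \<comment> \<open>\<open>{..<N}\<close> consists of \<open>3 * s\<close> blocks of length
    \<open>K\<close>, each the union of \<open>r\<close> progressions of difference \<open>r\<close>
    and length \<open>K'\<close>. It also has room for all forbidden points, which lie below
    \<open>3 * s * K'\<close>.\<close>
  define N where "N = 3 * s * K"
  have K': "K' \<ge> M" "K' \<ge> 1" using l MD mult_le_mono[of M M 1 l] by (auto simp: K'_def)
  have N_real: "real N = 3 * real s * real r * real K'" by (simp add: N_def K_def)
  have NK: "N \<ge> K'"
  proof -
    have "3 * s * r \<ge> 1" using r s by (simp add: Suc_le_eq)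
    then have "1 * K' \<le> 3 * s * r * K'" by (rule mult_le_mono1)
    then show ?thesis by (simp add: N_def K_def ac_simps)
  qed
  obtain A where A: "A \<subseteq> {..<N}" "config_free r s A" "card A = ?R N"
    using max_config_free_attained[of N r s] by blast
  have cA: "\<alpha> * real N \<le> real (card A)" using \<alpha>_le[of N] A(3) NK K' by simp
  define cnt where "cnt v u = card {j. j < K' \<and> (v + u * K) + j * r \<in> A}" for v u
  have cnt_le: "real (cnt v u) \<le> (\<alpha> + \<epsilon>) * real K'" for v u
  proof -
    have "cnt v u \<le> M * ?R l" unfolding cnt_def K'_def by (rule config_free_card_long_progression_le[OF A(2) r])
    then have "real (cnt v u) \<le> real M * real (?R l)" by (metis of_nat_le_iff of_nat_mult)
    also have "\<dots> \<le> real M * ((\<alpha> + \<epsilon>) * real l)" by (intro mult_left_mono l) auto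
    finally show ?thesis by (simp add: K'_def ac_simps)
  qed
  let ?I = "{..<r} \<times> {..<3 * s}"
  have total: "card A \<le> (\<Sum>(v, u)\<in>?I. cnt v u)"
  proof -
    have "A \<subseteq> (\<Union>p\<in>?I. (\<lambda>j. (fst p + snd p * K) + j * r) ` {j. j < K' \<and> (fst p + snd p * K) + j * r \<in> A})"
    proof
      fix x assume x: "x \<in> A"
      then have xN: "x < N" using A by auto
      have Kp: "K > 0" using K' r by (simp add: K_def)
      define u where "u = x div K"
      define v where "v = x mod K mod r"
      define j where "j = x mod K div r"
      have "u < 3 * s" using xN Kp unfolding u_def N_def by (simp add: div_less_iff_less_mult)
      moreover have "v < r" using r by (simp add: v_def)
      moreover have "x mod K < r * K'" using Kp unfolding K_def by simp
      then have "j < K'" unfolding j_def by (simp add: less_mult_imp_div_less mult.commute)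
      moreover have x_eq: "(v + u * K) + j * r = x"
        unfolding u_def v_def j_def by (metis add.assoc add.commute div_mult_mod_eq)
      ultimately show "x \<in> (\<Union>p\<in>?I. (\<lambda>j. (fst p + snd p * K) + j * r) ` {j. j < K' \<and> (fst p + snd p * K) + j * r \<in> A})"
        using x by (intro UN_I[of "(v, u)"] image_eqI[of _ _ j]) auto
    qed
    then have "card A \<le> card (\<Union>p\<in>?I. (\<lambda>j. (fst p + snd p * K) + j * r) ` {j. j < K' \<and> (fst p + snd p * K) + j * r \<in> A})"
      by (intro card_mono) auto
    also have "\<dots> \<le> (\<Sum>p\<in>?I. card ((\<lambda>j. (fst p + snd p * K) + j * r) ` {j. j < K' \<and> (fst p + snd p * K) + j * r \<in> A}))"
      by (rule card_UN_le) auto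
    also have "\<dots> \<le> (\<Sum>p\<in>?I. cnt (fst p) (snd p))" unfolding cnt_def
      by (intro sum_mono card_image_le) auto
    finally show ?thesis by (simp add: case_prod_beta)
  qed
  \<comment> \<open>On average a progression contains at least \<open>\<alpha> * K'\<close> elements
    of \<open>A\<close>, and none contains more than \<open>(\<alpha> + \<epsilon>) * K'\<close>. So
    none can fall far below the average: \<open>\<epsilon>\<close> is so small that even all
    \<open>3 * s * r\<close> excesses together amount to at most
    \<open>\<alpha> * \<alpha> / 8 * K'\<close>.\<close>
  have cnt_ge: "\<alpha> / 2 * real K' \<le> real (cnt v u)" if "v < r" "u < 3 * s" for v u
  proof -
    have mem: "(v, u) \<in> ?I" using that by simp
    have "real (card A) \<le> (\<Sum>p\<in>?I. real (cnt (fst p) (snd p)))"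
      using total by (simp add: case_prod_beta flip: of_nat_sum)
    also have "\<dots> = real (cnt v u) + (\<Sum>p\<in>?I - {(v, u)}. real (cnt (fst p) (snd p)))"
      by (subst sum.remove[OF _ mem]) auto
    also have "(\<Sum>p\<in>?I - {(v, u)}. real (cnt (fst p) (snd p))) \<le> real (card (?I - {(v, u)})) * ((\<alpha> + \<epsilon>) * real K')"
      by (rule sum_bounded_above) (rule cnt_le)
    also have "card (?I - {(v, u)}) = 3 * s * r - 1" using mem by (simp add: card_Diff_singleton ac_simps)
    also have "real (3 * s * r - 1) = 3 * real s * real r - 1" using r s by (simp add: of_nat_diff)
    finally have "\<alpha> * (3 * real s * real r * real K') \<le> real (cnt v u) + (3 * real s * real r - 1) * ((\<alpha> + \<epsilon>) * real K')"
      using cA N_real by simp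
    then have "(\<alpha> + \<epsilon>) * real K' - 3 * real s * real r * \<epsilon> * real K' \<le> real (cnt v u)"
      by (simp add: algebra_simps)
    moreover have "3 * real s * real r * \<epsilon> = \<alpha> * \<alpha> / 8"
      unfolding \<epsilon>_def c_def using r s by (simp add: field_simps)
    then have "3 * real s * real r * \<epsilon> * real K' = \<alpha> * \<alpha> / 8 * real K'" by simp
    moreover have "\<alpha> * \<alpha> / 8 * real K' \<le> \<alpha> / 2 * real K'"
      using \<alpha>1 \<alpha>_pos by (intro mult_right_mono) (auto simp: mult_le_cancel_left1)
    moreover have "0 \<le> \<epsilon> * real K'" using \<epsilon>_pos by simp
    moreover have "(\<alpha> + \<epsilon>) * real K' = \<alpha> / 2 * real K' + \<alpha> / 2 * real K' + \<epsilon> * real K'"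
      by (simp add: algebra_simps)
    ultimately show ?thesis by linarith
  qed
  \<comment> \<open>Both sets live in residue class 0 modulo \<open>r\<close>, in the blocks 0 and
    1. As \<open>K = r * K'\<close>, an \<open>m\<close> in \<open>Y\<close> stands for the element
    \<open>r * (K' + m)\<close>, and \<open>j < K'\<close> keeps the step \<open>K' + m - j\<close>
    positive.\<close>
  define X where "X = {j. j < K' \<and> j * r \<in> A}"
  define Y where "Y = {j. j < K' \<and> K + j * r \<in> A}"
  have cX: "\<alpha> / 2 * real K' \<le> real (card X)" using cnt_ge[of 0 0] r s by (simp add: cnt_def X_def)
  have cY: "\<alpha> / 2 * real K' \<le> real (card Y)" using cnt_ge[of 0 1] r s by (simp add: cnt_def Y_def)
  obtain m ds where ds: "length ds = k" "\<forall>d\<in>set ds. 1 \<le> d \<and> d \<le> D" "cube_in Y m ds"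
  proof -
    have "Y \<subseteq> {..<K'}" "D \<le> K'" using K'(1) MD(1) by (auto simp: Y_def)
    then show ?thesis using D cY that by blast
  qed
  define F where "F M = (\<lambda>(j, m). r * j + s * (K' + m - j)) ` (X \<times> M)" for M
  have F_Un: "F (M \<union> M') = F M \<union> F M'" for M M' by (auto simp: F_def)
  have F_bound: "F M \<subseteq> {..<N}" if "M \<subseteq> Y" for M
  proof
    fix z assume "z \<in> F M"
    then obtain j m where "j \<in> X" "m \<in> M" and z: "z = r * j + s * (K' + m - j)" by (auto simp: F_def)
    then have jm: "j < K'" "m < K'" using that by (auto simp: X_def Y_def)
    have "z \<le> s * j + s * (K' + m - j)" using z rs by simp
    also have "\<dots> = s * (K' + m)" using jm by (simp flip: distrib_left)
    also have "\<dots> < s * (3 * K')" using jm s by simp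
    also have "\<dots> \<le> N" unfolding N_def K_def using r by simp
    finally show "z \<in> {..<N}" by simp
  qed
  have F_card: "card X \<le> card (F {m})"
  proof -
    have "inj_on (\<lambda>j. r * j + s * (K' + m - j)) X"
    proof (rule inj_onI)
      fix i j assume *: "i \<in> X" "j \<in> X" "r * i + s * (K' + m - i) = r * j + s * (K' + m - j)"
      then have ij: "i \<le> K' + m" "j \<le> K' + m" by (auto simp: X_def)
      have "int r * int i + int s * (int (K' + m) - int i) = int r * int j + int s * (int (K' + m) - int j)"
        using *(3) ij by (metis of_nat_add of_nat_diff of_nat_mult)
      then have "(int s - int r) * (int i - int j) = 0" by (simp add: algebra_simps)
      then show "i = j" using rs by simp
    qed
    moreover have "F {m} = (\<lambda>j. r * j + s * (K' + m - j)) ` X" by (auto simp: F_def)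
    ultimately show ?thesis by (simp add: card_image)
  qed
  \<comment> \<open>The largest growth that \<open>k\<close> steps could sustain inside
    \<open>{..<N}\<close>: \<open>k * Suc g\<close> exceeds \<open>N\<close>.\<close>
  define g where "g = N div k"
  have "N < k * Suc g" unfolding g_def using k_pos by (metis dividend_less_times_div mult_Suc_right)
  then have "card (F {m}) + length ds * Suc g > N" using ds by simp
  then obtain M' d where M': "d \<in> set ds" "{m} \<subseteq> M'" "M' \<subseteq> Y" "card (F ((\<lambda>m. m + d) ` M') - F M') \<le> g"
    using cube_almost_invariant[of F Y N "{m}" ds g] F_Un F_bound ds(3) by auto
  have shift: "F ((\<lambda>m. m + d) ` M') = (\<lambda>f. f + s * d) ` F M'"
  proof -
    have "r * j + s * (K' + (m + d) - j) = r * j + s * (K' + m - j) + s * d" if "j \<in> X" for j m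
    proof -
      have "K' + (m + d) - j = (K' + m - j) + d" using that by (auto simp: X_def)
      then show ?thesis by (simp add: distrib_left)
    qed
    then show ?thesis unfolding F_def by (force simp: image_iff)
  qed
  have disj: "F M' \<inter> A = {}"
  proof (rule equals0I)
    fix z assume "z \<in> F M' \<inter> A"
    then obtain j m where jm: "j \<in> X" "m \<in> Y" "z = r * j + s * (K' + m - j)" "z \<in> A" using M'(3) by (auto simp: F_def)
    have "r * (K' + m) = r * j + r * (K' + m - j)" using jm by (simp add: X_def flip: distrib_left)
    then have "r * j \<in> A" "r * j + r * (K' + m - j) \<in> A" using jm by (auto simp: X_def Y_def K_def ac_simps distrib_left)
    moreover have "K' + m - j \<ge> 1" using jm by (auto simp: X_def)
    ultimately show False using A(2) jm unfolding config_free_def by blast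
  qed
  have d: "1 \<le> d" "d \<le> D" using ds M' by auto
  have FN: "card (F M') \<le> N" using F_bound[OF M'(3)] by (metis card_lessThan card_mono finite_lessThan)
  have "card (F {m}) \<le> card (F M')"
    using M'(2) F_bound[OF M'(3)] by (intro card_mono) (auto simp: F_def finite_subset)
  then have "\<alpha> / 2 * real K' \<le> real (card (F M'))" using F_card cX by linarith
  moreover have "\<alpha> / 2 * real K' = c * real N" unfolding c_def N_real using r s by (simp add: field_simps)
  ultimately have Fc: "c * real N \<le> real (card (F M'))" by simp
  have "l * card A \<le> l * (l * (s * d)) + ?R l * (N - card (F M') + l * g)"
    using card_avoiding_almost_invariant[OF A(1,2) F_bound[OF M'(3)] disj, of "s * d" g l] d s M'(4) shift by simp
  then have "real (l * card A) \<le> real (l * (l * (s * d)) + ?R l * (N - card (F M') + l * g))" by (simp only: of_nat_le_iff)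
  then have "real l * real (card A) \<le> real l * (real l * (real s * real d)) +
      real (?R l) * (real N - real (card (F M')) + real l * real g)"
    unfolding of_nat_add of_nat_mult of_nat_diff[OF FN] .
  also have "\<dots> \<le> real l * (real l * (real s * real D)) + ((\<alpha> + \<epsilon>) * real l) * (real N - c * real N + real l * (real N / real k))"
  proof (intro add_mono mult_mono mult_left_mono)
    show "real g \<le> real N / real k" unfolding g_def by (rule of_nat_div_le_of_nat)
    show "0 \<le> real N - real (card (F M')) + real l * real g" using FN by simp
  qed (use d l Fc \<alpha>_pos \<epsilon>_pos in auto)
  finally have "real l * real (card A) \<le> real l * (real l * real s * real D + (\<alpha> + \<epsilon>) * (real N - c * real N + real l * (real N / real k)))"
    by (simp only: distrib_left mult.assoc mult.left_commute)
  then have "real (card A) \<le> real l * real s * real D + (\<alpha> + \<epsilon>) * (real N - c * real N + real l * (real N / real k))"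
    using l(1) by simp
  then have main: "\<alpha> * real N \<le> real l * real s * real D + (\<alpha> + \<epsilon>) * (real N - c * real N) + (\<alpha> + \<epsilon>) * (real l * (real N / real k))"
    using cA by (simp only: distrib_left)
  have Npos: "real N > 0" using NK K' by simp
  have 1: "real l * real s * real D \<le> 1 / 4 * (\<alpha> * c * real N)"
  proof -
    have "4 * real l * real s * real D \<le> real M * (\<alpha> * c)" using M4 \<alpha>_pos c_pos by (simp add: divide_le_eq)
    also have "\<dots> \<le> real N * (\<alpha> * c)" using K' NK \<alpha>_pos c_pos by (intro mult_right_mono) auto
    finally show ?thesis by (simp add: algebra_simps)
  qed
  have 2: "(\<alpha> + \<epsilon>) * (real l * (real N / real k)) \<le> 1 / 4 * (\<alpha> * c * real N)"
  proof -
    have "8 * real l \<le> real k * (\<alpha> * c)" using k \<alpha>_pos c_pos by (simp add: divide_le_eq)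
    then have "real l / real k \<le> \<alpha> * c / 8" using k_pos by (simp add: field_simps)
    then have "(\<alpha> + \<epsilon>) * (real l / real k) \<le> 2 * (\<alpha> * c / 8)"
      using \<alpha>1 \<epsilon>1 \<alpha>_pos \<epsilon>_pos by (intro mult_mono) auto
    then have "(\<alpha> + \<epsilon>) * (real l / real k) * real N \<le> 2 * (\<alpha> * c / 8) * real N" by (intro mult_right_mono) auto
    then show ?thesis by (simp add: algebra_simps)
  qed
  have "(\<alpha> + \<epsilon>) * (real N - c * real N) \<le> (\<alpha> + \<epsilon> - \<alpha> * c) * real N"
    using \<epsilon>_pos c_pos Npos by (simp add: algebra_simps)
  also have "\<dots> = \<alpha> * real N - 3 / 4 * (\<alpha> * c * real N)" by (simp add: \<epsilon>_def algebra_simps)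
  finally have "\<alpha> * c * real N \<le> 0" using main 1 2 by linarith
  moreover have "\<alpha> * c * real N > 0" using \<alpha>_pos c_pos Npos by simp
  ultimately show False by simp
qed

theorem Roth_configuration:
  fixes \<delta> :: real
  assumes "1 \<le> r" and "1 \<le> s" and "0 < \<delta>"
  shows "\<exists>L\<ge>1. \<forall>J \<subseteq> {..<L}. \<delta> * real L \<le> real (card J) \<longrightarrow>
    (\<exists>i n. n \<ge> 1 \<and> i \<in> J \<and> i + r * n \<in> J \<and> i + s * n \<in> J)"
proof -
  have *: "\<exists>L\<ge>1. \<forall>J \<subseteq> {..<L}. \<delta> * real L \<le> real (card J) \<longrightarrow>
    (\<exists>i n. n \<ge> 1 \<and> i \<in> J \<and> i + a * n \<in> J \<and> i + b * n \<in> J)" if ab: "1 \<le> a" "a < b" for a b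
  proof -
    obtain L where L: "L \<ge> 1" "real (max_config_free a b L) < \<delta> * real L"
      using max_config_free_sublinear[OF ab assms(3)] by blast
    show ?thesis
    proof (rule exI[of _ L], intro conjI allI impI, rule L(1))
      fix J assume J: "J \<subseteq> {..<L}" "\<delta> * real L \<le> real (card J)"
      then have "\<not> config_free a b J" using L(2) config_free_card_le[of J L a b] by linarith
      then show "\<exists>i n. n \<ge> 1 \<and> i \<in> J \<and> i + a * n \<in> J \<and> i + b * n \<in> J" unfolding config_free_def by blast
    qed
  qed
  consider "r < s" | "s < r" | "r = s" by linarith
  then show ?thesis
  proof cases
    case 1
    show ?thesis by (rule *[OF assms(1) 1])
  next
    case 2
    then show ?thesis using *[OF assms(2) 2] by meson
  next
    \<comment> \<open>The configuration for \<open>r\<close> and \<open>Suc r\<close> already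
      contains the two points wanted here.\<close>
    case 3
    then show ?thesis using *[OF assms(1) lessI] by meson
  qed
qed

subsection \<open>Covering numbers and shattered sets of times\<close>

text \<open>
  \<open>E z w\<close> is the event that the letter \<open>w\<close> occurs at time \<open>z\<close>. A function \<open>b\<close> stands for the member
  \<open>{y. \<forall>z\<in>Z. y \<notin> E z (b z)}\<close> of the cover by sets that omit one letter at each time, so \<open>\<mu>\<close>
  bounds a covering number.
\<close>

definition avoidable ::
    "('i \<Rightarrow> 'w \<Rightarrow> 'a set) \<Rightarrow> 'w set \<Rightarrow> 'a set \<Rightarrow> 'i set \<Rightarrow> real \<Rightarrow> bool" where
  "avoidable E W Y Z \<mu> \<longleftrightarrow> (\<exists>B. finite B \<and> real (card B) \<le> \<mu> \<and> (\<forall>b\<in>B. \<forall>z\<in>Z. b z \<in> W) \<and>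
     (\<forall>y\<in>Y. \<exists>b\<in>B. \<forall>z\<in>Z. y \<notin> E z (b z)))"

definition shattered ::
    "('i \<Rightarrow> 'w \<Rightarrow> 'a set) \<Rightarrow> 'w set \<Rightarrow> 'a set \<Rightarrow> 'i set \<Rightarrow> bool" where
  "shattered E W Y I \<longleftrightarrow> (\<forall>\<sigma>. (\<forall>z\<in>I. \<sigma> z \<in> W) \<longrightarrow> (\<exists>y\<in>Y. \<forall>z\<in>I. y \<in> E z (\<sigma> z)))"

lemma avoidableI:
  assumes "finite B" "real (card B) \<le> \<mu>" "\<And>b z. b \<in> B \<Longrightarrow> z \<in> Z \<Longrightarrow> b z \<in> W"
    "\<And>y. y \<in> Y \<Longrightarrow> \<exists>b\<in>B. \<forall>z\<in>Z. y \<notin> E z (b z)"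
  shows "avoidable E W Y Z \<mu>"
  unfolding avoidable_def using assms by blast

lemma avoidableE:
  assumes "avoidable E W Y Z \<mu>"
  obtains B where "finite B" "real (card B) \<le> \<mu>" "\<And>b z. b \<in> B \<Longrightarrow> z \<in> Z \<Longrightarrow> b z \<in> W"
    "\<And>y. y \<in> Y \<Longrightarrow> \<exists>b\<in>B. \<forall>z\<in>Z. y \<notin> E z (b z)"
  using assms unfolding avoidable_def by blast

lemma avoidable_mono: "avoidable E W Y Z \<mu> \<Longrightarrow> \<mu> \<le> \<nu> \<Longrightarrow> avoidable E W Y Z \<nu>"
  unfolding avoidable_def by (meson order_trans)

lemma avoidable_empty_times: "1 \<le> \<mu> \<Longrightarrow> avoidable E W Y {} \<mu>"
  by (rule avoidableI[of "{undefined}"]) auto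

lemma avoidable_empty: "0 \<le> \<mu> \<Longrightarrow> avoidable E W {} Z \<mu>"
  by (rule avoidableI[of "{}"]) auto

text \<open>All of \<open>Y\<close> misses the letter \<open>i\<close> at time \<open>z\<close>, so
  every function can be given the value \<open>i\<close> there and no further functions
  arise.\<close>

lemma avoidable_insert:
  assumes "avoidable E W Y Z \<mu>" and "i \<in> W" and "z \<notin> Z" and "Y \<inter> E z i = {}"
  shows "avoidable E W Y (insert z Z) \<mu>"
proof -
  obtain B where B: "finite B" "real (card B) \<le> \<mu>" "\<And>b z. b \<in> B \<Longrightarrow> z \<in> Z \<Longrightarrow> b z \<in> W"
    "\<And>y. y \<in> Y \<Longrightarrow> \<exists>b\<in>B. \<forall>z\<in>Z. y \<notin> E z (b z)"
    using avoidableE[OF assms(1)] by metis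
  show ?thesis
  proof (rule avoidableI[of "(\<lambda>b. b(z := i)) ` B"])
    show "real (card ((\<lambda>b. b(z := i)) ` B)) \<le> \<mu>"
      using B(2) card_image_le[OF B(1), of "\<lambda>b. b(z := i)"] by linarith
    fix y assume y: "y \<in> Y"
    then obtain b where b: "b \<in> B" "\<forall>z\<in>Z. y \<notin> E z (b z)" using B(4) by blast
    have "\<forall>z'\<in>insert z Z. y \<notin> E z' ((b(z := i)) z')" using b y assms(3,4) by auto
    then show "\<exists>b\<in>(\<lambda>b. b(z := i)) ` B. \<forall>z\<in>insert z Z. y \<notin> E z (b z)" using b(1) by blast
  qed (use B assms in auto)
qed

lemma avoidable_Un:
  assumes "avoidable E W Y Z \<mu>" and "avoidable E W Y' Z \<nu>"
  shows "avoidable E W (Y \<union> Y') Z (\<mu> + \<nu>)"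
proof -
  obtain B where B: "finite B" "real (card B) \<le> \<mu>" "\<And>b z. b \<in> B \<Longrightarrow> z \<in> Z \<Longrightarrow> b z \<in> W"
    "\<And>y. y \<in> Y \<Longrightarrow> \<exists>b\<in>B. \<forall>z\<in>Z. y \<notin> E z (b z)"
    using avoidableE[OF assms(1)] by metis
  obtain B' where B': "finite B'" "real (card B') \<le> \<nu>" "\<And>b z. b \<in> B' \<Longrightarrow> z \<in> Z \<Longrightarrow> b z \<in> W"
    "\<And>y. y \<in> Y' \<Longrightarrow> \<exists>b\<in>B'. \<forall>z\<in>Z. y \<notin> E z (b z)"
    using avoidableE[OF assms(2)] by metis
  show ?thesis
  proof (rule avoidableI[of "B \<union> B'"])
    show "real (card (B \<union> B')) \<le> \<mu> + \<nu>" using card_Un_le[of B B'] B(2) B'(2) by linarith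
    show "\<exists>b\<in>B \<union> B'. \<forall>z\<in>Z. y \<notin> E z (b z)" if "y \<in> Y \<union> Y'" for y
      using that B(4)[of y] B'(4)[of y] by blast
    show "finite (B \<union> B')" using B(1) B'(1) by simp
    show "b z \<in> W" if "b \<in> B \<union> B'" "z \<in> Z" for b z using that B(3)[of b z] B'(3)[of b z] by blast
  qed
qed

text \<open>Choose one avoiding function for each \<open>c\<close> and merge their letters at each
  time by \<open>g\<close>; there are at most \<open>\<nu> ^ card C\<close> such choices. This is
  submultiplicativity of covering numbers under common refinement, applied below to the pieces of a
  cell and to the members of an open cover.\<close>

lemma avoidable_product:
  assumes C: "finite C" and av: "\<And>c. c \<in> C \<Longrightarrow> avoidable (E c) W Y Z \<nu>"
    and gW: "\<And>h. (\<And>c. c \<in> C \<Longrightarrow> h c \<in> W) \<Longrightarrow> g h \<in> W'"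
    and gE: "\<And>h y z. y \<in> Y \<Longrightarrow> z \<in> Z \<Longrightarrow> (\<And>c. c \<in> C \<Longrightarrow> h c \<in> W) \<Longrightarrow>
       (\<And>c. c \<in> C \<Longrightarrow> y \<notin> E c z (h c)) \<Longrightarrow> y \<notin> E' z (g h)"
  shows "avoidable E' W' Y Z (\<nu> ^ card C)"
proof -
  have "\<forall>c\<in>C. \<exists>B. finite B \<and> real (card B) \<le> \<nu> \<and> (\<forall>b\<in>B. \<forall>z\<in>Z. b z \<in> W) \<and>
     (\<forall>y\<in>Y. \<exists>b\<in>B. \<forall>z\<in>Z. y \<notin> E c z (b z))"
    using av unfolding avoidable_def by (rule ballI)
  from bchoice[OF this] obtain B where "\<forall>c\<in>C. finite (B c) \<and> real (card (B c)) \<le> \<nu> \<and>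
     (\<forall>b\<in>B c. \<forall>z\<in>Z. b z \<in> W) \<and> (\<forall>y\<in>Y. \<exists>b\<in>B c. \<forall>z\<in>Z. y \<notin> E c z (b z))" ..
  then have B: "c \<in> C \<Longrightarrow> finite (B c)" "c \<in> C \<Longrightarrow> real (card (B c)) \<le> \<nu>"
     "c \<in> C \<Longrightarrow> b \<in> B c \<Longrightarrow> z \<in> Z \<Longrightarrow> b z \<in> W"
     "c \<in> C \<Longrightarrow> y \<in> Y \<Longrightarrow> \<exists>b\<in>B c. \<forall>z\<in>Z. y \<notin> E c z (b z)" for c b z y
    by simp_all
  let ?B = "(\<lambda>f z. g (\<lambda>c. f c z)) ` PiE C B"
  have fin: "finite (PiE C B)" using C B(1) by (rule finite_PiE)
  show ?thesis
  proof (rule avoidableI[of ?B])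
    have "real (card ?B) \<le> real (card (PiE C B))" using card_image_le[OF fin] by simp
    also have "\<dots> = (\<Prod>c\<in>C. real (card (B c)))" using C by (simp add: card_PiE)
    also have "\<dots> \<le> (\<Prod>c\<in>C. \<nu>)" using B(2) by (intro prod_mono) auto
    finally show "real (card ?B) \<le> \<nu> ^ card C" by simp
  next
    fix b z assume "b \<in> ?B" "z \<in> Z"
    then obtain f where f: "f \<in> PiE C B" "b = (\<lambda>z. g (\<lambda>c. f c z))" by auto
    have "f c z \<in> W" if "c \<in> C" for c
      by (rule B(3)[OF that _ \<open>z \<in> Z\<close>]) (use f that in auto)
    then show "b z \<in> W'" unfolding f(2) by (rule gW[of "\<lambda>c. f c z"])
  next
    fix y assume y: "y \<in> Y"
    have "\<forall>c\<in>C. \<exists>b. b \<in> B c \<and> (\<forall>z\<in>Z. y \<notin> E c z (b z))" using B(4) y by blast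
    from bchoice[OF this] obtain b where "\<forall>c\<in>C. b c \<in> B c \<and> (\<forall>z\<in>Z. y \<notin> E c z (b c z))" ..
    then have b: "c \<in> C \<Longrightarrow> b c \<in> B c" "c \<in> C \<Longrightarrow> z \<in> Z \<Longrightarrow> y \<notin> E c z (b c z)" for c z
      by simp_all
    have "y \<notin> E' z (g (\<lambda>c. restrict b C c z))" if z: "z \<in> Z" for z
    proof (rule gE[OF y z, of "\<lambda>c. restrict b C c z"])
      show "restrict b C c z \<in> W" if "c \<in> C" for c
        using B(3)[OF that b(1)[OF that] z] that by simp
      show "y \<notin> E c z (restrict b C c z)" if "c \<in> C" for c using b(2)[OF that z] that by simp
    qed
    moreover have "restrict b C \<in> PiE C B" using b(1) by simp
    ultimately show "\<exists>b\<in>?B. \<forall>z\<in>Z. y \<notin> E' z (b z)"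
      by (intro bexI[of _ "\<lambda>z. g (\<lambda>c. restrict b C c z)"] ballI imageI)
  qed (use fin in simp)
qed

section \<open>Counting shattered sets of times by a weighted Sauer-Shelah argument\<close>

lemma shatteredD:
  "shattered E W Y I \<Longrightarrow> (\<And>z. z \<in> I \<Longrightarrow> \<sigma> z \<in> W) \<Longrightarrow> \<exists>y\<in>Y. \<forall>z\<in>I. y \<in> E z (\<sigma> z)"
  unfolding shattered_def by blast

lemma shattered_subset: "shattered E W Y I \<Longrightarrow> Y \<subseteq> Y' \<Longrightarrow> shattered E W Y' I"
  unfolding shattered_def by blast

lemma shattered_insert:
  assumes "\<And>i. i \<in> W \<Longrightarrow> shattered E W (Y \<inter> E z i) I"
  shows "shattered E W Y (insert z I)"
  unfolding shattered_def
proof (intro allI impI)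
  fix \<sigma> assume \<sigma>: "\<forall>z\<in>insert z I. \<sigma> z \<in> W"
  then have "shattered E W (Y \<inter> E z (\<sigma> z)) I" using assms by simp
  then obtain y where "y \<in> Y \<inter> E z (\<sigma> z)" "\<forall>z\<in>I. y \<in> E z (\<sigma> z)" using \<sigma> unfolding shattered_def by blast
  then show "\<exists>y\<in>Y. \<forall>z\<in>insert z I. y \<in> E z (\<sigma> z)" by blast
qed

text \<open>For two letters this is the number of shattered sets, as in Pajor's form of the
  Sauer-Shelah lemma. For more letters the base \<open>q = 1 / (card W - 1)\<close> is the solution
  of \<open>q * card W = 1 + q\<close>, the identity that makes splitting along a letter
  work.\<close>

definition shatter_weight ::
    "('i \<Rightarrow> 'w \<Rightarrow> 'a set) \<Rightarrow> 'w set \<Rightarrow> 'a set \<Rightarrow> 'i set \<Rightarrow> real" where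
  "shatter_weight E W Y Z =
     (\<Sum>I\<in>Pow Z. if shattered E W Y I then (1 / (real (card W) - 1)) ^ card I else 0)"

text \<open>Compare the contributions for each \<open>I\<close>. If all parts of \<open>Y\<close>
  shatter \<open>I\<close>, then \<open>Y\<close> shatters \<open>I\<close> and
  \<open>insert z I\<close>, and \<open>q * card W = 1 + q\<close> gives equality. If some but at
  most \<open>card W - 1\<close> parts do, then \<open>Y\<close> shatters \<open>I\<close>, and
  \<open>q * (card W - 1) = 1\<close> suffices.\<close>

lemma shatter_weight_insert_ge:
  assumes Z: "finite Z" "z \<notin> Z" and W: "finite W" "card W \<ge> 2"
  shows "shatter_weight E W Y (insert z Z) \<ge>
    1 / (real (card W) - 1) * (\<Sum>i\<in>W. shatter_weight E W (Y \<inter> E z i) Z)"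
proof -
  define q where "q = 1 / (real (card W) - 1)"
  have k: "real (card W) - 1 \<ge> 1" using W by simp
  then have q: "q > 0" by (simp add: q_def)
  define sh where "sh Y I = (if shattered E W Y I then q ^ card I else 0)" for Y I
  have sh_nonneg: "sh Y I \<ge> 0" for Y I using q by (simp add: sh_def)
  have ptw: "q * (\<Sum>i\<in>W. sh (Y \<inter> E z i) I) \<le> sh Y I + sh Y (insert z I)" if I: "I \<in> Pow Z" for I
  proof -
    let ?n = "card {i\<in>W. shattered E W (Y \<inter> E z i) I}"
    have "(\<Sum>i\<in>W. sh (Y \<inter> E z i) I) = (\<Sum>i\<in>{i\<in>W. shattered E W (Y \<inter> E z i) I}. q ^ card I)"
      unfolding sh_def by (rule sum.inter_filter[OF W(1), symmetric])
    then have sum: "(\<Sum>i\<in>W. sh (Y \<inter> E z i) I) = real ?n * q ^ card I" by simp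
    show ?thesis
    proof (cases "\<forall>i\<in>W. shattered E W (Y \<inter> E z i) I")
      case True
      have "W \<noteq> {}" using W by auto
      then have "shattered E W Y I" using True shattered_subset[of E W _ I Y] by blast
      moreover have "shattered E W Y (insert z I)" using True by (intro shattered_insert) auto
      moreover have "card (insert z I) = Suc (card I)" using I Z by (intro card_insert_disjoint) (auto intro: finite_subset)
      moreover have "?n = card W" using True by (intro arg_cong[of _ _ card]) auto
      moreover have "q * real (card W) = 1 + q" unfolding q_def using k by (simp add: field_simps)
      then have "q * (real (card W) * q ^ card I) = q ^ card I + q * q ^ card I"
        by (metis distrib_right mult.assoc mult_1)
      ultimately show ?thesis using sum by (simp add: sh_def)
    next
      case False
      then have "{i\<in>W. shattered E W (Y \<inter> E z i) I} \<subset> W" by blast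
      then have "?n < card W" using W(1) by (intro psubset_card_mono)
      then have n: "real ?n \<le> real (card W) - 1" by linarith
      show ?thesis
      proof (cases "?n = 0")
        case True
        then show ?thesis using sum sh_nonneg[of Y I] sh_nonneg[of Y "insert z I"] by simp
      next
        case n0: False
        then obtain i where "i \<in> W" "shattered E W (Y \<inter> E z i) I" by (metis (mono_tags, lifting) Collect_empty_eq card.empty)
        then have "shattered E W Y I" using shattered_subset by blast
        then have "sh Y I = q ^ card I" by (simp add: sh_def)
        moreover have "q * real ?n \<le> 1" using n k unfolding q_def by (simp add: field_simps)
        then have "q * real ?n * q ^ card I \<le> 1 * q ^ card I" using q by (intro mult_right_mono) auto
        ultimately show ?thesis using sum sh_nonneg[of Y "insert z I"] by (simp add: mult.assoc)
      qed
    qed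
  qed
  have "q * (\<Sum>i\<in>W. \<Sum>I\<in>Pow Z. sh (Y \<inter> E z i) I) = (\<Sum>I\<in>Pow Z. q * (\<Sum>i\<in>W. sh (Y \<inter> E z i) I))"
    by (subst sum.swap) (simp add: sum_distrib_left)
  also have "\<dots> \<le> (\<Sum>I\<in>Pow Z. sh Y I + sh Y (insert z I))" by (intro sum_mono ptw)
  also have "\<dots> = (\<Sum>I\<in>Pow Z. sh Y I) + (\<Sum>I\<in>insert z ` Pow Z. sh Y I)"
    using Z by (subst sum.reindex) (auto simp: sum.distrib inj_on_def insert_ident)
  also have "\<dots> = (\<Sum>I\<in>Pow (insert z Z). sh Y I)"
    unfolding Pow_insert using Z by (intro sum.union_disjoint[symmetric]) auto
  finally show ?thesis unfolding shatter_weight_def sh_def q_def .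
qed

lemma shatter_weight_mono:
  assumes "finite Z" "Y \<subseteq> Y'" "Z' \<subseteq> Z" "card W \<ge> 2"
  shows "shatter_weight E W Y Z' \<le> shatter_weight E W Y' Z"
proof -
  have q: "1 / (real (card W) - 1) \<ge> 0" using assms(4) by simp
  have "shatter_weight E W Y Z' \<le> shatter_weight E W Y' Z'"
    unfolding shatter_weight_def
    by (intro sum_mono) (use shattered_subset[OF _ assms(2)] q in \<open>auto intro!: zero_le_power\<close>)
  also have "\<dots> \<le> shatter_weight E W Y' Z"
    unfolding shatter_weight_def
    by (intro sum_mono2) (use assms(1,3) q in auto)
  finally show ?thesis .
qed

text \<open>
  Either some time \<open>z\<close> can be dropped while losing at most the factor \<open>1 - t\<close> of the
  covering number, or splitting \<open>Y\<close> along the letter at \<open>z\<close> leaves at least the fraction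
  \<open>t\<close> of it in each of the \<open>card W\<close> parts.
\<close>

lemma shatter_weight_ge:
  fixes Z :: "'c set"
  assumes "finite Z" and W: "finite W" "card W \<ge> 2" and t: "0 < t" "t < 1"
    and disj: "\<And>z i j. i \<in> W \<Longrightarrow> j \<in> W \<Longrightarrow> i \<noteq> j \<Longrightarrow> E z i \<inter> E z j = {}"
  shows "\<not> avoidable E W Y Z \<mu> \<Longrightarrow> 1 \<le> \<mu> * (1 - t) ^ card Z * t ^ D \<Longrightarrow>
     (real (card W) / (real (card W) - 1)) ^ D \<le> shatter_weight E W Y Z"
  using assms(1)
proof (induction Z arbitrary: Y \<mu> D rule: finite_induct)
  case (empty Y \<mu> D)
  have "1 \<le> \<mu>"
  proof (rule ccontr)
    assume "\<not> 1 \<le> \<mu>"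
    then have "\<mu> * t ^ D < 1 * t ^ D" using t by (intro mult_strict_right_mono) auto
    moreover have "t ^ D \<le> 1" using t by (intro power_le_one) auto
    ultimately show False using empty.prems(2) by simp
  qed
  then show ?case using empty.prems(1) avoidable_empty_times by blast
next
  case (insert z Z Y \<mu> D)
  have t': "0 < (1 - t) ^ card (insert z Z)" "0 < t ^ D" using t by auto
  have \<mu>: "\<mu> > 0"
  proof (rule ccontr)
    assume "\<not> \<mu> > 0"
    then have "\<mu> * (1 - t) ^ card (insert z Z) * t ^ D \<le> 0"
      using t' by (intro mult_nonpos_nonneg) auto
    then show False using insert.prems(2) by linarith
  qed
  have cZ: "card (insert z Z) = Suc (card Z)" using insert.hyps by simp
  \<comment> \<open>\<open>D\<close> is the number of splittings still to be made. The hypothesis on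
    \<open>\<mu>\<close> is a budget: it pays a factor \<open>1 - t\<close> for every time in the
    set and a factor \<open>t\<close> for each of the \<open>D\<close> splittings.\<close>
  show ?case
  proof (cases D)
    case 0
    have "Y \<noteq> {}" using insert.prems(1) avoidable_empty[of \<mu> E W "insert z Z"] \<mu> by fastforce
    then have "shattered E W Y {}" unfolding shattered_def by blast
    moreover have "(if shattered E W Y {} then (1 / (real (card W) - 1)) ^ card ({} :: 'c set) else 0)
        \<le> shatter_weight E W Y (insert z Z)"
      unfolding shatter_weight_def using insert.hyps W
      by (intro member_le_sum[where f = "\<lambda>I. if shattered E W Y I then (1 / (real (card W) - 1)) ^ card I else 0"]) auto
    ultimately show ?thesis using 0 by simp
  next
    case (Suc D')
    show ?thesis
    proof (cases "\<exists>i\<in>W. \<not> avoidable E W (Y - E z i) (insert z Z) ((1 - t) * \<mu>)")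
      case True
      then obtain i where i: "i \<in> W" "\<not> avoidable E W (Y - E z i) (insert z Z) ((1 - t) * \<mu>)" by blast
      then have "\<not> avoidable E W (Y - E z i) Z ((1 - t) * \<mu>)"
        using avoidable_insert[of E W "Y - E z i" Z "(1 - t) * \<mu>" i z] insert.hyps by blast
      moreover have "1 \<le> (1 - t) * \<mu> * (1 - t) ^ card Z * t ^ D" using insert.prems(2) cZ by (simp add: ac_simps)
      ultimately have "(real (card W) / (real (card W) - 1)) ^ D \<le> shatter_weight E W (Y - E z i) Z"
        by (rule insert.IH)
      also have "\<dots> \<le> shatter_weight E W Y (insert z Z)"
        using insert.hyps W by (intro shatter_weight_mono) auto
      finally show ?thesis .
    next
      case False
      have each: "(real (card W) / (real (card W) - 1)) ^ D' \<le> shatter_weight E W (Y \<inter> E z i) Z" if i: "i \<in> W" for i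
      proof (rule insert.IH)
        show "\<not> avoidable E W (Y \<inter> E z i) Z (t * \<mu>)"
        proof
          assume av: "avoidable E W (Y \<inter> E z i) Z (t * \<mu>)"
          \<comment> \<open>Points of \<open>E z i\<close> miss any second letter \<open>j\<close>
            at time \<open>z\<close>, so the time \<open>z\<close> can be added at no cost to a
            family avoiding on \<open>Z\<close>.\<close>
          have "card (W - {i}) \<noteq> 0" using W i by simp
          then have "W - {i} \<noteq> {}" by (metis card.empty)
          then obtain j where j: "j \<in> W" "j \<noteq> i" by blast
          have "Y \<inter> E z i \<inter> E z j = {}" using disj[OF i j(1)] j(2) by blast
          then have "avoidable E W (Y \<inter> E z i) (insert z Z) (t * \<mu>)"
            using avoidable_insert[OF av j(1)] insert.hyps by blast
          moreover have "avoidable E W (Y - E z i) (insert z Z) ((1 - t) * \<mu>)" using False i by blast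
          ultimately have "avoidable E W ((Y \<inter> E z i) \<union> (Y - E z i)) (insert z Z) (t * \<mu> + (1 - t) * \<mu>)"
            by (rule avoidable_Un)
          moreover have "(Y \<inter> E z i) \<union> (Y - E z i) = Y" by blast
          moreover have "t * \<mu> + (1 - t) * \<mu> = \<mu>" by (simp add: algebra_simps)
          ultimately show False using insert.prems(1) by simp
        qed
        have "1 \<le> \<mu> * ((1 - t) * (1 - t) ^ card Z) * (t * t ^ D')" using insert.prems(2) cZ Suc by simp
        also have "\<dots> = (1 - t) * (t * \<mu> * (1 - t) ^ card Z * t ^ D')" by (simp add: ac_simps)
        also have "\<dots> \<le> 1 * (t * \<mu> * (1 - t) ^ card Z * t ^ D')"
          using t \<mu> by (intro mult_right_mono) auto
        finally show "1 \<le> t * \<mu> * (1 - t) ^ card Z * t ^ D'" by simp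
      qed
      let ?\<rho> = "real (card W) / (real (card W) - 1)"
      have "?\<rho> ^ D = 1 / (real (card W) - 1) * (\<Sum>i\<in>W. ?\<rho> ^ D')" using Suc by simp
      also have "\<dots> \<le> 1 / (real (card W) - 1) * (\<Sum>i\<in>W. shatter_weight E W (Y \<inter> E z i) Z)"
        using W each by (intro mult_left_mono sum_mono) auto
      also have "\<dots> \<le> shatter_weight E W Y (insert z Z)"
        by (rule shatter_weight_insert_ge) (use insert.hyps W in auto)
      finally show ?thesis .
    qed
  qed
qed

lemma sum_Pow_power_card:
  fixes x :: real
  assumes "finite Z"
  shows "(\<Sum>I\<in>Pow Z. x ^ card I) = (1 + x) ^ card Z"
  using assms
proof (induction rule: finite_induct)
  case (insert z Z)
  have "(\<Sum>I\<in>insert z ` Pow Z. x ^ card I) = (\<Sum>I\<in>Pow Z. x ^ card (insert z I))"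
    using insert.hyps by (subst sum.reindex) (auto simp: inj_on_def insert_ident)
  also have "\<dots> = (\<Sum>I\<in>Pow Z. x * x ^ card I)"
  proof (rule sum.cong)
    fix I assume "I \<in> Pow Z"
    then have "card (insert z I) = Suc (card I)"
      using insert.hyps by (intro card_insert_disjoint) (auto intro: finite_subset)
    then show "x ^ card (insert z I) = x * x ^ card I" by simp
  qed simp
  finally have "(\<Sum>I\<in>insert z ` Pow Z. x ^ card I) = x * (1 + x) ^ card Z"
    using insert.IH by (simp flip: sum_distrib_left)
  moreover have "(\<Sum>I\<in>Pow (insert z Z). x ^ card I) = (\<Sum>I\<in>Pow Z. x ^ card I) + (\<Sum>I\<in>insert z ` Pow Z. x ^ card I)"
    unfolding Pow_insert using insert.hyps by (intro sum.union_disjoint) auto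
  ultimately show ?case using insert by (simp add: algebra_simps)
qed simp

text \<open>Exponential covering numbers force an exponentially large weight, through linearly many
  splittings. If only sets of size below a small multiple of \<open>card Z\<close> were shattered,
  there would be too few of them to carry that weight.\<close>

lemma not_avoidable_imp_dense_shattered:
  fixes \<theta> :: real
  assumes W: "finite W" "card W \<ge> 2" and \<theta>: "\<theta> > 1"
    and disj: "\<And>z i j. i \<in> W \<Longrightarrow> j \<in> W \<Longrightarrow> i \<noteq> j \<Longrightarrow> E z i \<inter> E z j = {}"
  shows "\<exists>c>0. \<exists>N0. \<forall>Z. finite Z \<longrightarrow> card Z \<ge> N0 \<longrightarrow> \<not> avoidable E W Y Z (\<theta> ^ card Z) \<longrightarrow>
     (\<exists>I \<subseteq> Z. c * real (card Z) \<le> real (card I) \<and> shattered E W Y I)"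
proof -
  \<comment> \<open>The growth \<open>\<theta>\<close> is shared equally: dropping times costs
    \<open>1 - t = 1 / s\<close> each, and the remaining \<open>s ^ N\<close> pays for
    \<open>D\<close> splittings as long as \<open>D \<le> \<kappa> * N\<close>.\<close>
  define s where "s = sqrt \<theta>"
  have s: "s > 1" "s * s = \<theta>" using \<theta> by (auto simp: s_def)
  define t where "t = 1 - 1 / s"
  have t: "0 < t" "t < 1" using s by (auto simp: t_def)
  define \<kappa> where "\<kappa> = ln s / - ln t"
  have lnt: "- ln t > 0" using t by simp
  have \<kappa>: "\<kappa> > 0" using s lnt unfolding \<kappa>_def by (intro divide_pos_pos) auto
  define \<rho> where "\<rho> = real (card W) / (real (card W) - 1)"
  have "real (card W) \<ge> 2" using W(2) by simp
  then have \<rho>: "\<rho> > 1" by (simp add: \<rho>_def)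
  \<comment> \<open>A Chernoff bound for the number of small sets:
    \<open>exp (\<beta> * N) * x ^ card I \<ge> 1\<close> when \<open>card I \<le> c * N\<close>,
    and \<open>1 + x \<le> exp \<beta>\<close>, so the total is at most
    \<open>exp (2 * \<beta> * N)\<close>. The 4 makes this the square root of \<open>\<rho>\<close>
    to the power \<open>\<kappa> * N\<close>.\<close>
  define \<beta> where "\<beta> = \<kappa> * ln \<rho> / 4"
  have \<beta>: "\<beta> > 0" using \<kappa> \<rho> by (simp add: \<beta>_def)
  define x where "x = min 1 \<beta>"
  have x: "0 < x" "x \<le> 1" "x \<le> \<beta>" using \<beta> by (auto simp: x_def)
  define c where "c = \<beta> / (1 - ln x)"
  have lnx: "ln x \<le> 0" using x by simp
  then have c: "c > 0" using \<beta> by (simp add: c_def)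
  have clnx: "c * - ln x \<le> \<beta>"
  proof -
    have "c * (1 - ln x) = \<beta>" unfolding c_def using lnx by simp
    then show ?thesis using c by (simp add: algebra_simps)
  qed
  obtain N0 :: nat where N0: "real N0 > ln \<rho> / (2 * \<beta>)" using reals_Archimedean2 by blast
  show ?thesis
  proof (intro exI[of _ c] exI[of _ N0] conjI c allI impI)
    fix Z assume Z: "finite Z" "N0 \<le> card Z" "\<not> avoidable E W Y Z (\<theta> ^ card Z)"
    define N where "N = card Z"
    have lnN: "ln \<rho> < 2 * \<beta> * real N"
    proof -
      have "ln \<rho> < 2 * \<beta> * real N0" using N0 \<beta> by (simp add: divide_less_eq mult.commute)
      also have "\<dots> \<le> 2 * \<beta> * real N" using Z(2) \<beta> by (simp add: N_def)
      finally show ?thesis .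
    qed
    define D where "D = nat \<lfloor>\<kappa> * real N\<rfloor>"
    have D: "real D \<le> \<kappa> * real N" "\<kappa> * real N - 1 \<le> real D" unfolding D_def using \<kappa> by (auto simp: of_nat_nat)
    have "1 \<le> \<theta> ^ N * (1 - t) ^ N * t ^ D"
    proof -
      have "\<theta> * (1 - t) = s" using s by (auto simp: t_def field_simps)
      then have 1: "\<theta> ^ N * (1 - t) ^ N = s ^ N" by (metis power_mult_distrib)
      have "s ^ N * t ^ D = exp (real N * ln s) * exp (real D * ln t)"
        using s t by (simp add: exp_of_nat_mult)
      also have "\<dots> = exp (real N * ln s - real D * - ln t)" by (simp flip: exp_add)
      also have "\<dots> \<ge> 1"
      proof -
        have "real D * - ln t \<le> \<kappa> * real N * - ln t" using D(1) lnt by (intro mult_right_mono) auto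
        also have "\<dots> = real N * ln s" using lnt by (simp add: \<kappa>_def)
        finally show ?thesis by simp
      qed
      finally show ?thesis using 1 by simp
    qed
    then have lower: "\<rho> ^ D \<le> shatter_weight E W Y Z"
      unfolding \<rho>_def using Z W t disj by (intro shatter_weight_ge[where \<mu> = "\<theta> ^ card Z" and t = t]) (auto simp: N_def)
    show "\<exists>I\<subseteq>Z. c * real (card Z) \<le> real (card I) \<and> shattered E W Y I"
    proof (rule ccontr)
      assume "\<not> ?thesis"
      then have small: "real (card I) < c * real N" if "I \<subseteq> Z" "shattered E W Y I" for I
        using that unfolding N_def by (meson not_less)
      have "shatter_weight E W Y Z \<le> (\<Sum>I\<in>Pow Z. exp (\<beta> * real N) * x ^ card I)"
        unfolding shatter_weight_def
      proof (rule sum_mono)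
        fix I assume I: "I \<in> Pow Z"
        show "(if shattered E W Y I then (1 / (real (card W) - 1)) ^ card I else 0) \<le> exp (\<beta> * real N) * x ^ card I"
        proof (cases "shattered E W Y I")
          case True
          have "(1 / (real (card W) - 1)) ^ card I \<le> 1" using W(2) by (intro power_le_one) auto
          also have "1 \<le> exp (\<beta> * real N + real (card I) * ln x)"
          proof -
            have "real (card I) * - ln x \<le> c * real N * - ln x"
              using small[of I] I True lnx by (intro mult_right_mono) auto
            also have "\<dots> = c * - ln x * real N" by simp
            also have "\<dots> \<le> \<beta> * real N" using clnx by (intro mult_right_mono) auto
            finally show ?thesis by simp
          qed
          also have "\<dots> = exp (\<beta> * real N) * x ^ card I" using x by (simp add: exp_add exp_of_nat_mult)
          finally show ?thesis using True by simp
        qed (use x in simp)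
      qed
      also have "\<dots> = exp (\<beta> * real N) * (1 + x) ^ N"
        using Z(1) by (simp add: sum_Pow_power_card N_def flip: sum_distrib_left)
      also have "\<dots> \<le> exp (\<beta> * real N) * exp \<beta> ^ N"
        using x order_trans[OF _ exp_ge_add_one_self[of \<beta>], of "1 + x"] by (intro mult_left_mono power_mono) auto
      also have "\<dots> = exp (2 * \<beta> * real N)" by (simp flip: exp_of_nat_mult exp_add add: algebra_simps)
      finally have "\<rho> ^ D \<le> exp (2 * \<beta> * real N)" using lower by linarith
      moreover have "\<rho> ^ D = exp (real D * ln \<rho>)" using \<rho> by (simp add: exp_of_nat_mult)
      ultimately have "real D * ln \<rho> \<le> 2 * \<beta> * real N" by simp
      moreover have "(\<kappa> * real N - 1) * ln \<rho> \<le> real D * ln \<rho>" using D(2) \<rho> by (intro mult_right_mono) auto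
      moreover have "(\<kappa> * real N - 1) * ln \<rho> = 4 * \<beta> * real N - ln \<rho>" by (simp add: \<beta>_def algebra_simps)
      ultimately show False using lnN by linarith
    qed
  qed
qed

text \<open>A point that realizes the word \<open>\<sigma>\<close> on \<open>J\<close> is served by
  some \<open>b\<close> in \<open>B\<close>, and then \<open>\<sigma>\<close> differs from
  \<open>b\<close> throughout \<open>J\<close>. Each \<open>b\<close> accounts for only
  \<open>(card W - 1) ^ card J\<close> of the \<open>card W ^ card J\<close> words.\<close>

lemma shattered_not_avoidable:
  assumes sh: "shattered E W Y J" and J: "J \<subseteq> Z" "finite J" and W: "finite W" "card W \<ge> 2"
    and av: "avoidable E W Y Z \<mu>"
  shows "(real (card W) / (real (card W) - 1)) ^ card J \<le> \<mu>"
proof -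
  obtain B where B: "finite B" "real (card B) \<le> \<mu>" "\<And>b z. b \<in> B \<Longrightarrow> z \<in> Z \<Longrightarrow> b z \<in> W"
    "\<And>y. y \<in> Y \<Longrightarrow> \<exists>b\<in>B. \<forall>z\<in>Z. y \<notin> E z (b z)"
    using avoidableE[OF av] by metis
  have "PiE J (\<lambda>_. W) \<subseteq> (\<Union>b\<in>B. PiE J (\<lambda>z. W - {b z}))"
  proof
    fix \<sigma> assume \<sigma>: "\<sigma> \<in> PiE J (\<lambda>_. W)"
    then have "\<forall>z\<in>J. \<sigma> z \<in> W" by auto
    then obtain y where y: "y \<in> Y" "\<forall>z\<in>J. y \<in> E z (\<sigma> z)" using sh unfolding shattered_def by blast
    then obtain b where b: "b \<in> B" "\<forall>z\<in>Z. y \<notin> E z (b z)" using B(4) by blast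
    have "\<sigma> z \<noteq> b z" if "z \<in> J" for z using y(2) b(2) J(1) that by (metis subsetD)
    then have "\<sigma> \<in> PiE J (\<lambda>z. W - {b z})" using \<sigma> by (auto simp: PiE_iff)
    then show "\<sigma> \<in> (\<Union>b\<in>B. PiE J (\<lambda>z. W - {b z}))" using b(1) by blast
  qed
  then have "card (PiE J (\<lambda>_. W)) \<le> card (\<Union>b\<in>B. PiE J (\<lambda>z. W - {b z}))"
    using B(1) J(2) W(1) by (intro card_mono finite_UN_I finite_PiE) auto
  also have "\<dots> \<le> (\<Sum>b\<in>B. card (PiE J (\<lambda>z. W - {b z})))" by (rule card_UN_le[OF B(1)])
  also have "\<dots> = (\<Sum>b\<in>B. (card W - 1) ^ card J)"
  proof (rule sum.cong)
    fix b assume "b \<in> B"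
    then have "card (W - {b z}) = card W - 1" if "z \<in> J" for z using that B(3) J(1) by (simp add: subsetD)
    then show "card (PiE J (\<lambda>z. W - {b z})) = (card W - 1) ^ card J" using J(2) by (simp add: card_PiE)
  qed simp
  finally have "card W ^ card J \<le> card B * (card W - 1) ^ card J" using J(2) by (simp add: card_PiE)
  then have "real (card W ^ card J) \<le> real (card B * (card W - 1) ^ card J)" by (simp only: of_nat_le_iff)
  then have "real (card W) ^ card J \<le> real (card B) * (real (card W) - 1) ^ card J" using W(2) by (simp add: of_nat_diff)
  also have "\<dots> \<le> \<mu> * (real (card W) - 1) ^ card J" using B(2) W(2) by (intro mult_right_mono) auto
  finally show ?thesis using W(2) by (simp add: power_divide divide_le_eq)
qed

subsection \<open>Separated configurations in dense sets\<close>

text \<open>Varnavides' averaging: a positive fraction of the windows of length \<open>L\<close> has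
  density at least \<open>c / 2\<close>, each such window contains a configuration, and one of the
  \<open>L * L\<close> choices of offset and step occurs often.\<close>

lemma dense_set_many_configurations:
  fixes c :: real
  assumes rs: "1 \<le> r" "1 \<le> s" and c: "0 < c"
  shows "\<exists>c'>0. \<exists>L N0. \<forall>N\<ge>N0. \<forall>J\<subseteq>{..<N}. c * real N \<le> real (card J) \<longrightarrow>
    (\<exists>n. 1 \<le> n \<and> n \<le> L \<and> c' * real N \<le> real (card {i\<in>J. i + r * n \<in> J \<and> i + s * n \<in> J}))"
proof -
  have "c / 2 > 0" using c by simp
  from Roth_configuration[OF rs this] obtain L where L: "L \<ge> 1"
    "\<forall>J \<subseteq> {..<L}. c / 2 * real L \<le> real (card J) \<longrightarrow>
      (\<exists>i n. n \<ge> 1 \<and> i \<in> J \<and> i + r * n \<in> J \<and> i + s * n \<in> J)" by blast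
  obtain N0 :: nat where N0: "real N0 \<ge> 4 * real L / c" using real_arch_simple by blast
  define c' where "c' = c / (8 * (real L * real L))"
  have c': "c' > 0" using c L(1) by (simp add: c'_def)
  show ?thesis
  proof (rule exI[of _ c'], rule conjI[OF c'], rule exI[of _ L], rule exI[of _ "Suc N0"], intro allI impI)
    fix N J assume N: "Suc N0 \<le> N" and J: "J \<subseteq> {..<N}" and cJ: "c * real N \<le> real (card J)"
    have finJ: "finite J" using J finite_subset by blast
    have Npos: "real N > 0" using N by simp
    define S where "S n = {i\<in>J. i + r * n \<in> J \<and> i + s * n \<in> J}" for n
    define win where "win a = {j. j < L \<and> a + j \<in> J}" for a
    \<comment> \<open>The starts of the good windows. Averaging loses at most
      \<open>L \<le> c / 4 * N\<close> elements of \<open>J\<close> near 0, and poor windows account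
      for at most \<open>c / 2 * N\<close>, so \<open>c / 4 * N\<close> remains for
      \<open>G\<close>.\<close>
    define G where "G = {a\<in>{..<N}. c / 2 * real L \<le> real (card (win a))}"
    have win_le: "card (win a) \<le> L" for a
      using card_mono[of "{..<L}" "win a"] by (auto simp: win_def)
    have "(\<Sum>a<N. card (win a)) = (\<Sum>a<N. \<Sum>j<L. if a + j \<in> J then 1 else 0)"
    proof (rule sum.cong[OF refl])
      fix a
      have "win a = {j\<in>{..<L}. a + j \<in> J}" by (auto simp: win_def)
      then show "card (win a) = (\<Sum>j<L. if a + j \<in> J then 1 else 0)" by (simp flip: sum.inter_filter)
    qed
    also have "\<dots> = (\<Sum>j<L. \<Sum>a<N. if a + j \<in> J then 1 else 0)" by (rule sum.swap)
    also have "\<dots> = (\<Sum>j<L. card {a\<in>{..<N}. a + j \<in> J})" by (simp flip: sum.inter_filter)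
    also have "\<dots> \<ge> (\<Sum>j<L. card J - L)"
    proof (rule sum_mono)
      fix j assume j: "j \<in> {..<L}"
      have "card J - L \<le> card (J - {..<L})" using diff_card_le_card_Diff[of "{..<L}" J] by simp
      also have "\<dots> \<le> card {a\<in>{..<N}. a + j \<in> J}"
      proof (rule card_inj_on_le[of "\<lambda>x. x - j"])
        show "inj_on (\<lambda>x. x - j) (J - {..<L})" using j by (auto simp: inj_on_def)
        show "(\<lambda>x. x - j) ` (J - {..<L}) \<subseteq> {a\<in>{..<N}. a + j \<in> J}" using j J by (auto simp: subset_iff less_imp_diff_less)
      qed simp
      finally show "card J - L \<le> card {a\<in>{..<N}. a + j \<in> J}" .
    qed
    finally have "L * (card J - L) \<le> (\<Sum>a<N. card (win a))" by simp
    then have "real (L * (card J - L)) \<le> real (\<Sum>a<N. card (win a))" by (simp only: of_nat_le_iff)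
    moreover have "real (card J) - real L \<le> real (card J - L)"
      by (cases "L \<le> card J") (auto simp: of_nat_diff)
    then have "real L * (real (card J) - real L) \<le> real L * real (card J - L)" by (rule mult_left_mono) simp
    ultimately have "real L * (real (card J) - real L) \<le> (\<Sum>a<N. real (card (win a)))" by simp
    also have "\<dots> \<le> (\<Sum>a<N. c / 2 * real L + (if a \<in> G then real L else 0))"
    proof (rule sum_mono)
      fix a assume a: "a \<in> {..<N}"
      show "real (card (win a)) \<le> c / 2 * real L + (if a \<in> G then real L else 0)"
      proof (cases "a \<in> G")
        case True
        have "real (card (win a)) \<le> real L" "0 \<le> c / 2 * real L" using win_le[of a] c by auto
        then show ?thesis using True by simp
      qed (use a in \<open>auto simp: G_def\<close>)
    qed
    also have "\<dots> = real N * (c / 2 * real L) + (\<Sum>a<N. if a \<in> G then real L else 0)"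
      by (simp only: sum.distrib sum_constant card_lessThan)
    also have "(\<Sum>a<N. if a \<in> G then real L else 0) = (\<Sum>a\<in>{..<N} \<inter> G. real L)"
      by (rule sum.inter_restrict[symmetric]) simp
    also have "{..<N} \<inter> G = G" by (auto simp: G_def)
    finally have "real L * (real (card J) - real L) \<le> real L * (real N * (c / 2) + real (card G))"
      by (simp add: algebra_simps)
    then have "real (card J) - real L \<le> real N * (c / 2) + real (card G)" using L(1) by simp
    moreover have "real L \<le> c / 4 * real N"
    proof -
      have "4 * real L \<le> real N0 * c" using N0 c by (simp add: divide_le_eq)
      also have "\<dots> \<le> real N * c" using N c by (intro mult_right_mono) auto
      finally show ?thesis by (simp add: mult.commute)
    qed
    ultimately have G_ge: "c / 4 * real N \<le> real (card G)" using cJ by (simp add: algebra_simps)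
    show "\<exists>n. 1 \<le> n \<and> n \<le> L \<and> c' * real N \<le> real (card {i\<in>J. i + r * n \<in> J \<and> i + s * n \<in> J})"
    proof (rule ccontr)
      assume "\<not> ?thesis"
      then have small: "real (card (S n)) \<le> c' * real N" if "1 \<le> n" "n \<le> L" for n
        using that unfolding S_def by (meson less_imp_le not_less)
      have "G \<subseteq> (\<Union>p\<in>{..<L} \<times> {1..L}. {a. a + fst p \<in> S (snd p)})"
      proof
        fix a assume "a \<in> G"
        then have "win a \<subseteq> {..<L}" "c / 2 * real L \<le> real (card (win a))" by (auto simp: G_def win_def)
        then obtain i n where *: "n \<ge> 1" "i \<in> win a" "i + r * n \<in> win a" "i + s * n \<in> win a" using L(2) by blast
        have "1 * n \<le> r * n" using rs(1) by (rule mult_le_mono1)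
        moreover have "i + r * n < L" using *(3) by (simp add: win_def)
        ultimately have "n \<le> L" by linarith
        moreover have "a + i \<in> S n" using * by (simp add: S_def win_def add.assoc)
        ultimately show "a \<in> (\<Union>p\<in>{..<L} \<times> {1..L}. {a. a + fst p \<in> S (snd p)})"
          using * by (intro UN_I[of "(i, n)"]) (auto simp: win_def)
      qed
      then have "card G \<le> card (\<Union>p\<in>{..<L} \<times> {1..L}. {a. a + fst p \<in> S (snd p)})"
      proof (rule card_mono[rotated])
        show "finite (\<Union>p\<in>{..<L} \<times> {1..L}. {a. a + fst p \<in> S (snd p)})"
          by (rule finite_subset[of _ "{..<N}"]) (use J in \<open>auto simp: S_def\<close>)
      qed
      also have "\<dots> \<le> (\<Sum>p\<in>{..<L} \<times> {1..L}. card {a. a + fst p \<in> S (snd p)})" by (rule card_UN_le) simp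
      also have "\<dots> \<le> (\<Sum>p\<in>{..<L} \<times> {1..L}. card (S (snd p)))"
      proof (rule sum_mono)
        fix p :: "nat \<times> nat"
        show "card {a. a + fst p \<in> S (snd p)} \<le> card (S (snd p))"
          by (rule card_inj_on_le[of "\<lambda>a. a + fst p"]) (use finJ in \<open>auto simp: S_def inj_on_def\<close>)
      qed
      finally have "real (card G) \<le> (\<Sum>p\<in>{..<L} \<times> {1..L}. real (card (S (snd p))))" by (simp flip: of_nat_sum)
      also have "\<dots> \<le> (\<Sum>p\<in>{..<L} \<times> {1..L}. c' * real N)" by (intro sum_mono small) auto
      also have "\<dots> = real L * real L * c' * real N" by simp
      also have "\<dots> = c / 8 * real N" using L(1) by (simp add: c'_def)
      finally have "c / 4 * real N \<le> c / 8 * real N" using G_ge by linarith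
      then show False using c Npos by simp
    qed
  qed
qed

lemma dense_residue_class:
  assumes "finite S" and "m \<ge> 1"
  shows "\<exists>S'\<subseteq>S. card S \<le> m * card S' \<and> (\<forall>i\<in>S'. \<forall>j\<in>S'. i mod m = j mod (m::nat))"
proof (rule ccontr)
  assume "\<not> ?thesis"
  then have *: "m * card {i\<in>S. i mod m = a} < card S" for a
    by (metis (mono_tags, lifting) mem_Collect_eq not_less subsetI)
  have "S \<subseteq> (\<Union>a<m. {i\<in>S. i mod m = a})" using assms(2) by auto
  then have "card S \<le> card (\<Union>a<m. {i\<in>S. i mod m = a})" using assms(1) by (intro card_mono) auto
  also have "\<dots> \<le> (\<Sum>a<m. card {i\<in>S. i mod m = a})" by (rule card_UN_le) simp
  finally have "m * card S \<le> (\<Sum>a<m. m * card {i\<in>S. i mod m = a})"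
    by (simp flip: sum_distrib_left)
  also have "\<dots> < (\<Sum>a<m. card S)" using * assms(2) by (intro sum_strict_mono) (auto simp: lessThan_empty_iff)
  finally show False by simp
qed

text \<open>Restricting to one residue class modulo \<open>r * n + s * n + 1\<close> makes
  configurations with different base points disjoint, so letters can be prescribed on each
  independently. The modulus is bounded because \<open>n \<le> L\<close>, hence density drops only
  by a constant factor.\<close>

lemma dense_set_separated_configurations:
  fixes c :: real
  assumes rs: "1 \<le> r" "1 \<le> s" and c: "0 < c"
  shows "\<exists>c'>0. \<exists>L N0. \<forall>N\<ge>N0. \<forall>J\<subseteq>{..<N}. c * real N \<le> real (card J) \<longrightarrow>
    (\<exists>n S. 1 \<le> n \<and> n \<le> L \<and> S \<subseteq> J \<and> c' * real N \<le> real (card S) \<and>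
       (\<forall>i\<in>S. i + r * n \<in> J \<and> i + s * n \<in> J) \<and>
       (\<forall>i\<in>S. \<forall>j\<in>S. i mod (r * n + s * n + 1) = j mod (r * n + s * n + 1)))"
proof -
  obtain c' L N0 where 1: "c' > 0" "\<forall>N\<ge>N0. \<forall>J\<subseteq>{..<N}. c * real N \<le> real (card J) \<longrightarrow>
    (\<exists>n. 1 \<le> n \<and> n \<le> L \<and> c' * real N \<le> real (card {i\<in>J. i + r * n \<in> J \<and> i + s * n \<in> J}))"
    using dense_set_many_configurations[OF assms] by blast
  define M where "M = r * L + s * L + 1"
  have "M > 0" by (simp add: M_def)
  then have M: "real M > 0" by simp
  show ?thesis
  proof (rule exI[of _ "c' / real M"], rule conjI, use 1(1) M in simp, rule exI[of _ L], rule exI[of _ N0], intro allI impI)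
    fix N J assume *: "N0 \<le> N" "J \<subseteq> {..<N}" "c * real N \<le> real (card J)"
    then obtain n where n: "1 \<le> n" "n \<le> L" "c' * real N \<le> real (card {i\<in>J. i + r * n \<in> J \<and> i + s * n \<in> J})"
      using 1(2) by blast
    let ?m = "r * n + s * n + 1"
    define Q where "Q = {i\<in>J. i + r * n \<in> J \<and> i + s * n \<in> J}"
    have "finite Q" unfolding Q_def
      by (rule finite_subset[OF _ finite_lessThan[of N]]) (use *(2) in auto)
    moreover have "1 \<le> ?m" by simp
    ultimately have "\<exists>S\<subseteq>Q. card Q \<le> ?m * card S \<and> (\<forall>i\<in>S. \<forall>j\<in>S. i mod ?m = j mod ?m)"
      by (rule dense_residue_class)
    then obtain S where S: "S \<subseteq> Q" "card Q \<le> ?m * card S" "\<forall>i\<in>S. \<forall>j\<in>S. i mod ?m = j mod ?m"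
      by (elim exE conjE)
    have "?m \<le> M" using n(2) by (simp add: M_def add_mono)
    then have "?m * card S \<le> M * card S" by (rule mult_le_mono1)
    then have "real (card Q) \<le> real (M * card S)"
      unfolding of_nat_le_iff using S(2) by linarith
    then have "c' * real N \<le> real M * real (card S)" using n(3) unfolding Q_def by simp
    then have card_S: "c' / real M * real N \<le> real (card S)" using M by (simp add: field_simps)
    have S_J: "S \<subseteq> J" "\<forall>i\<in>S. i + r * n \<in> J \<and> i + s * n \<in> J" using S(1) unfolding Q_def by blast+
    show "\<exists>n S. 1 \<le> n \<and> n \<le> L \<and> S \<subseteq> J \<and> c' / real M * real N \<le> real (card S) \<and>
       (\<forall>i\<in>S. i + r * n \<in> J \<and> i + s * n \<in> J) \<and>
       (\<forall>i\<in>S. \<forall>j\<in>S. i mod (r * n + s * n + 1) = j mod (r * n + s * n + 1))"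
      by (intro exI[of _ n] exI[of _ S] conjI n(1,2) S_J card_S S(3))
  qed
qed

subsection \<open>Independence sets of positive density\<close>

definition visits :: "('a \<Rightarrow> 'a) \<Rightarrow> ('w \<Rightarrow> 'a set) \<Rightarrow> nat \<Rightarrow> 'w \<Rightarrow> 'a set" where
  "visits T A n w = {x. (T ^^ n) x \<in> A w}"

text \<open>Each of infinitely many lengths \<open>N\<close> has its own \<open>J\<close>, with a
  common density \<open>c\<close>. Growth along a subsequence of lengths is what positive entropy
  supplies here, and it survives pigeonholing over finitely many cases.\<close>

definition dense_indep :: "'a set \<Rightarrow> ('a \<Rightarrow> 'a) \<Rightarrow> ('w \<Rightarrow> 'a set) \<Rightarrow> 'w set \<Rightarrow> bool" where
  "dense_indep X T A W \<longleftrightarrow> (\<exists>c>0. \<exists>\<^sub>F N in sequentially.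
     \<exists>J\<subseteq>{..<N}. c * real N \<le> real (card J) \<and> shattered (visits T A) W X J)"

text \<open>Exponential growth of the covers described at \<open>avoidable\<close>. For finitely
  many, at least two, pairwise disjoint cells it is equivalent to \<open>dense_indep\<close>; this
  is the form that passes to a piece of a cell.\<close>

definition exp_cover :: "'a set \<Rightarrow> ('a \<Rightarrow> 'a) \<Rightarrow> ('w \<Rightarrow> 'a set) \<Rightarrow> 'w set \<Rightarrow> bool" where
  "exp_cover X T A W \<longleftrightarrow> (\<exists>\<theta>>1. \<exists>\<^sub>F N in sequentially.
     \<not> avoidable (visits T A) W X {..<N} (\<theta> ^ N))"

lemma exp_cover_imp_dense_indep:
  assumes "exp_cover X T A W" and W: "finite W" "card W \<ge> 2"
    and disj: "\<And>i j. i \<in> W \<Longrightarrow> j \<in> W \<Longrightarrow> i \<noteq> j \<Longrightarrow> A i \<inter> A j = {}"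
  shows "dense_indep X T A W"
proof -
  obtain \<theta> where \<theta>: "\<theta> > 1" "\<exists>\<^sub>F N in sequentially. \<not> avoidable (visits T A) W X {..<N} (\<theta> ^ N)"
    using assms(1) unfolding exp_cover_def by blast
  have "visits T A z i \<inter> visits T A z j = {}" if "i \<in> W" "j \<in> W" "i \<noteq> j" for z i j
    using disj[OF that] by (auto simp: visits_def)
  from not_avoidable_imp_dense_shattered[OF W \<theta>(1), of "visits T A" X, OF this]
  obtain c N0 where c: "c > 0" and N0: "\<forall>Z. finite Z \<longrightarrow> card Z \<ge> N0 \<longrightarrow> \<not> avoidable (visits T A) W X Z (\<theta> ^ card Z) \<longrightarrow>
     (\<exists>I \<subseteq> Z. c * real (card Z) \<le> real (card I) \<and> shattered (visits T A) W X I)" by blast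
  have "\<exists>\<^sub>F N in sequentially. \<exists>J\<subseteq>{..<N}. c * real N \<le> real (card J) \<and> shattered (visits T A) W X J"
  proof (rule frequently_rev_mp[OF \<theta>(2)], rule eventually_mono[OF eventually_ge_at_top[of N0]], rule impI)
    fix N assume "N0 \<le> N" "\<not> avoidable (visits T A) W X {..<N} (\<theta> ^ N)"
    then show "\<exists>J\<subseteq>{..<N}. c * real N \<le> real (card J) \<and> shattered (visits T A) W X J"
      using N0[rule_format, of "{..<N}"] by simp
  qed
  then show ?thesis unfolding dense_indep_def using c by blast
qed

lemma dense_indep_imp_exp_cover:
  assumes "dense_indep X T A W" and W: "finite W" "card W \<ge> 2"
  shows "exp_cover X T A W"
proof -
  obtain c where c: "c > 0" and freq: "\<exists>\<^sub>F N in sequentially. \<exists>J\<subseteq>{..<N}. c * real N \<le> real (card J) \<and> shattered (visits T A) W X J"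
    using assms(1) unfolding dense_indep_def by blast
  define \<rho> where "\<rho> = real (card W) / (real (card W) - 1)"
  have \<rho>: "\<rho> > 1" using W(2) by (simp add: \<rho>_def)
  define \<theta> where "\<theta> = \<rho> powr (c / 2)"
  have \<theta>: "\<theta> > 1" using \<rho> c by (simp add: \<theta>_def)
  have "\<exists>\<^sub>F N in sequentially. \<not> avoidable (visits T A) W X {..<N} (\<theta> ^ N)"
  proof (rule frequently_rev_mp[OF freq], rule eventually_mono[OF eventually_ge_at_top[of 1]], intro impI notI)
    fix N assume N: "1 \<le> N" and "\<exists>J\<subseteq>{..<N}. c * real N \<le> real (card J) \<and> shattered (visits T A) W X J"
      and av: "avoidable (visits T A) W X {..<N} (\<theta> ^ N)"
    then obtain J where J: "J \<subseteq> {..<N}" "c * real N \<le> real (card J)" "shattered (visits T A) W X J" by blast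
    have "\<rho> ^ card J \<le> \<theta> ^ N"
      unfolding \<rho>_def using shattered_not_avoidable[OF J(3) J(1) _ W av] J(1) finite_subset by blast
    also have "\<theta> ^ N = \<rho> powr (c / 2 * real N)" using \<rho> by (simp add: \<theta>_def powr_powr flip: powr_realpow)
    also have "\<rho> ^ card J = \<rho> powr real (card J)" using \<rho> by (simp add: powr_realpow)
    finally have "real (card J) \<le> c / 2 * real N" using \<rho> by simp
    moreover have "c / 2 * real N > 0" using c N by simp
    ultimately show False using J(2) by simp
  qed
  then show ?thesis unfolding exp_cover_def using \<theta> by blast
qed

lemma dense_indep_reindex:
  assumes "dense_indep X T A W" and "\<And>w. w \<in> W' \<Longrightarrow> f w \<in> W" and "\<And>w. w \<in> W' \<Longrightarrow> A (f w) \<subseteq> A' w"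
  shows "dense_indep X T A' W'"
proof -
  obtain c where c: "c > 0" and freq: "\<exists>\<^sub>F N in sequentially. \<exists>J\<subseteq>{..<N}. c * real N \<le> real (card J) \<and> shattered (visits T A) W X J"
    using assms(1) unfolding dense_indep_def by blast
  have sh: "shattered (visits T A') W' X J" if "shattered (visits T A) W X J" for J
    unfolding shattered_def
  proof (intro allI impI)
    fix \<sigma> assume \<sigma>: "\<forall>z\<in>J. \<sigma> z \<in> W'"
    then have "\<exists>x\<in>X. \<forall>z\<in>J. x \<in> visits T A z (f (\<sigma> z))"
      using assms(2) by (intro shatteredD[OF that]) blast
    then obtain x where "x \<in> X" "\<forall>z\<in>J. x \<in> visits T A z (f (\<sigma> z))" ..
    then show "\<exists>x\<in>X. \<forall>z\<in>J. x \<in> visits T A' z (\<sigma> z)"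
      using assms(3) \<sigma> by (intro bexI[of _ x]) (auto simp: visits_def)
  qed
  have "\<exists>\<^sub>F N in sequentially. \<exists>J\<subseteq>{..<N}. c * real N \<le> real (card J) \<and> shattered (visits T A') W' X J"
    by (rule frequently_elim1[OF freq]) (use sh in blast)
  then show ?thesis unfolding dense_indep_def using c by blast
qed

lemma exp_cover_shrink:
  assumes "exp_cover X T A W" and "w0 \<in> W" and C: "finite C" and cov: "A w0 \<subseteq> (\<Union>c\<in>C. P c)"
  shows "\<exists>c\<in>C. exp_cover X T (A(w0 := P c)) W"
proof (rule ccontr)
  assume none: "\<not> ?thesis"
  obtain \<theta> where \<theta>: "\<theta> > 1" "\<exists>\<^sub>F N in sequentially. \<not> avoidable (visits T A) W X {..<N} (\<theta> ^ N)"
    using assms(1) unfolding exp_cover_def by blast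
  \<comment> \<open>Multiplying \<open>card C\<close> covers of size \<open>\<theta>' ^ N\<close>
    must stay below \<open>\<theta> ^ N\<close>; the summand 1 keeps \<open>q\<close> positive for
    empty \<open>C\<close>.\<close>
  define q where "q = real (card C) + 1"
  define \<theta>' where "\<theta>' = \<theta> powr (1 / q)"
  have \<theta>': "\<theta>' > 1" using \<theta> by (simp add: \<theta>'_def q_def)
  have "\<forall>c\<in>C. \<forall>\<^sub>F N in sequentially. avoidable (visits T (A(w0 := P c))) W X {..<N} (\<theta>' ^ N)"
  proof
    fix c assume "c \<in> C"
    then have "\<not> exp_cover X T (A(w0 := P c)) W" using none by blast
    then have "\<not> (\<exists>\<^sub>F N in sequentially. \<not> avoidable (visits T (A(w0 := P c))) W X {..<N} (\<theta>' ^ N))"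
      using \<theta>' unfolding exp_cover_def by blast
    then show "\<forall>\<^sub>F N in sequentially. avoidable (visits T (A(w0 := P c))) W X {..<N} (\<theta>' ^ N)"
      by (simp add: not_frequently)
  qed
  then have "\<forall>\<^sub>F N in sequentially. \<forall>c\<in>C. avoidable (visits T (A(w0 := P c))) W X {..<N} (\<theta>' ^ N)"
    by (rule eventually_ball_finite[OF C])
  then have "\<forall>\<^sub>F N in sequentially. avoidable (visits T A) W X {..<N} (\<theta> ^ N)"
  proof (rule eventually_mono)
    fix N assume av: "\<forall>c\<in>C. avoidable (visits T (A(w0 := P c))) W X {..<N} (\<theta>' ^ N)"
    \<comment> \<open>A letter other than \<open>w0\<close> is avoided for the original cells too,
      because only the cell of \<open>w0\<close> was changed. If every \<open>c\<close> proposes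
      \<open>w0\<close>, the point misses all pieces, hence the whole cell
      \<open>A w0\<close>.\<close>
    define g where "g h = (if \<exists>c\<in>C. h c \<noteq> w0 then h (SOME c. c \<in> C \<and> h c \<noteq> w0) else w0)" for h
    have gc: "(\<exists>c\<in>C. h c \<noteq> w0 \<and> g h = h c) \<or> (\<forall>c\<in>C. h c = w0) \<and> g h = w0" for h
    proof (cases "\<exists>c\<in>C. h c \<noteq> w0")
      case True
      then have "(SOME c. c \<in> C \<and> h c \<noteq> w0) \<in> C \<and> h (SOME c. c \<in> C \<and> h c \<noteq> w0) \<noteq> w0"
        using someI_ex[of "\<lambda>c. c \<in> C \<and> h c \<noteq> w0"] by blast
      then show ?thesis using True unfolding g_def by auto
    qed (auto simp: g_def)
    have "avoidable (visits T A) W X {..<N} ((\<theta>' ^ N) ^ card C)"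
    proof (rule avoidable_product[OF C, where g = g])
      show "avoidable (visits T (A(w0 := P c))) W X {..<N} (\<theta>' ^ N)" if "c \<in> C" for c using av that by blast
      show "g h \<in> W" if "\<And>c. c \<in> C \<Longrightarrow> h c \<in> W" for h using gc[of h] that assms(2) by auto
      show "x \<notin> visits T A z (g h)" if *: "\<And>c. c \<in> C \<Longrightarrow> x \<notin> visits T (A(w0 := P c)) z (h c)" for h x z
        using gc[of h]
      proof
        assume "\<exists>c\<in>C. h c \<noteq> w0 \<and> g h = h c"
        then obtain c where "c \<in> C" "h c \<noteq> w0" "g h = h c" by blast
        then show ?thesis using *[of c] by (simp add: visits_def)
      next
        assume "(\<forall>c\<in>C. h c = w0) \<and> g h = w0"
        then show ?thesis using * cov by (fastforce simp: visits_def)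
      qed
    qed
    moreover have "(\<theta>' ^ N) ^ card C \<le> \<theta> ^ N"
    proof -
      have "(\<theta>' ^ N) ^ card C = \<theta> powr (real N * real (card C) / q)"
        using \<theta> by (simp add: \<theta>'_def powr_powr flip: powr_realpow)
      also have "\<dots> \<le> \<theta> powr real N"
        using \<theta> by (intro powr_mono) (auto simp: q_def divide_le_eq algebra_simps)
      finally show ?thesis using \<theta> by (simp add: powr_realpow)
    qed
    ultimately show "avoidable (visits T A) W X {..<N} (\<theta> ^ N)" by (rule avoidable_mono)
  qed
  then show False using \<theta>(2) by (simp add: frequently_def)
qed

text \<open>Along separated configurations in \<open>J\<close>, prescribe \<open>w\<close> at
  \<open>i\<close> and \<open>u\<close> at both \<open>i + r * n\<close> and
  \<open>i + s * n\<close>. Independence along \<open>J\<close> then makes the base points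
  \<open>i\<close> independence times for the cells indexed by \<open>(w, u)\<close>.\<close>

lemma dense_indep_return:
  assumes "dense_indep X T A W" and rs: "1 \<le> r" "1 \<le> s" and W: "W \<noteq> {}"
  shows "\<exists>n\<ge>n0. dense_indep X T
    (\<lambda>(w, u). {x \<in> A w. (T ^^ (r * n)) x \<in> A u \<and> (T ^^ (s * n)) x \<in> A u}) (W \<times> W)"
proof -
  obtain c where c: "c > 0" and freq: "\<exists>\<^sub>F N in sequentially. \<exists>J\<subseteq>{..<N}. c * real N \<le> real (card J) \<and> shattered (visits T A) W X J"
    using assms(1) unfolding dense_indep_def by blast
  obtain w0 where w0: "w0 \<in> W" using W by blast
  \<comment> \<open>Searching with the steps \<open>r * a\<close> and \<open>s * a\<close> makes the
    return parameter a multiple \<open>a * n\<close> of \<open>a\<close>, hence at least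
    \<open>n0\<close>.\<close>
  define a where "a = max 1 n0"
  have a: "a \<ge> 1" "a \<ge> n0" by (auto simp: a_def)
  have ra: "1 \<le> r * a" "1 \<le> s * a" using rs a by (auto simp: Suc_le_eq)
  obtain c' L N0 where c': "c' > 0" and conf: "\<forall>N\<ge>N0. \<forall>J\<subseteq>{..<N}. c * real N \<le> real (card J) \<longrightarrow>
    (\<exists>n S. 1 \<le> n \<and> n \<le> L \<and> S \<subseteq> J \<and> c' * real N \<le> real (card S) \<and>
       (\<forall>i\<in>S. i + r * a * n \<in> J \<and> i + s * a * n \<in> J) \<and>
       (\<forall>i\<in>S. \<forall>j\<in>S. i mod (r * a * n + s * a * n + 1) = j mod (r * a * n + s * a * n + 1)))"
    using dense_set_separated_configurations[OF ra c] by (elim exE conjE)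
  let ?A = "\<lambda>n (w, u). {x \<in> A w. (T ^^ (r * n)) x \<in> A u \<and> (T ^^ (s * n)) x \<in> A u}"
  have sh: "shattered (visits T (?A (a * n))) (W \<times> W) X S"
    if J: "shattered (visits T A) W X J" and n: "1 \<le> n" and S: "S \<subseteq> J"
      "\<forall>i\<in>S. i + r * a * n \<in> J \<and> i + s * a * n \<in> J"
      "\<forall>i\<in>S. \<forall>j\<in>S. i mod (r * a * n + s * a * n + 1) = j mod (r * a * n + s * a * n + 1)" for J n S
    unfolding shattered_def
  proof (intro allI impI)
    fix \<sigma> :: "nat \<Rightarrow> 'b \<times> 'b" assume \<sigma>: "\<forall>z\<in>S. \<sigma> z \<in> W \<times> W"
    let ?m = "r * a * n + s * a * n + 1"
    have pos: "r * a * n \<ge> 1" "s * a * n \<ge> 1" using ra n by (auto simp: Suc_le_eq)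
    have eq: "i = j" if "i \<in> S" "j \<in> S" "i \<le> j" "j < i + ?m" for i j
    proof -
      have "?m dvd j - i" using S(3) that by (metis mod_eq_dvd_iff_nat)
      then show ?thesis using that by (metis add_less_cancel_left le_add_diff_inverse nat_dvd_not_less add_0_right less_add_same_cancel1 bot_nat_0.not_eq_extremum)
    qed
    have eq': "i = j" if ij: "i \<in> S" "j \<in> S" and d: "i + p = j + p'" "p < ?m" "p' < ?m" for i j p p'
    proof (cases "i \<le> j")
      case True
      then show ?thesis using eq[of i j] ij d by linarith
    next
      case False
      then show ?thesis using eq[of j i] ij d by linarith
    qed
    \<comment> \<open>The word on \<open>J\<close> that realizes \<open>\<sigma>\<close>. Separation
      makes the base point picked by \<open>SOME\<close> unique; times outside all configurations
      get the default letter \<open>w0\<close>.\<close>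
    define \<tau> where "\<tau> z = (if z \<in> S then fst (\<sigma> z)
      else if \<exists>i\<in>S. z = i + r * a * n \<or> z = i + s * a * n
        then snd (\<sigma> (SOME i. i \<in> S \<and> (z = i + r * a * n \<or> z = i + s * a * n))) else w0)" for z
    have \<tau>1: "\<tau> i = fst (\<sigma> i)" if "i \<in> S" for i using that by (simp add: \<tau>_def)
    have \<tau>2: "\<tau> (i + p) = snd (\<sigma> i)" if i: "i \<in> S" and p: "p = r * a * n \<or> p = s * a * n" for i p
    proof -
      have p': "p \<ge> 1" "p < ?m" using p pos by auto
      have "i + p \<notin> S" using eq[OF i, of "i + p"] p' by auto
      moreover have ex: "\<exists>j\<in>S. i + p = j + r * a * n \<or> i + p = j + s * a * n" using i p by blast
      moreover have "(SOME j. j \<in> S \<and> (i + p = j + r * a * n \<or> i + p = j + s * a * n)) = i"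
      proof (rule some_equality)
        show "i \<in> S \<and> (i + p = i + r * a * n \<or> i + p = i + s * a * n)" using i p by blast
        fix j assume "j \<in> S \<and> (i + p = j + r * a * n \<or> i + p = j + s * a * n)"
        then show "j = i" using eq'[OF i, of j p "r * a * n"] eq'[OF i, of j p "s * a * n"] p' by auto
      qed
      ultimately show ?thesis by (simp add: \<tau>_def)
    qed
    have "\<tau> z \<in> W" for z
    proof -
      consider "z \<in> S" | "z \<notin> S" "\<exists>i\<in>S. z = i + r * a * n \<or> z = i + s * a * n"
        | "z \<notin> S" "\<not> (\<exists>i\<in>S. z = i + r * a * n \<or> z = i + s * a * n)" by blast
      then show ?thesis
      proof cases
        case 1
        then show ?thesis using \<tau>1[of z] \<sigma> by (metis mem_Times_iff)
      next
        case 2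
        then obtain i p where "i \<in> S" "p = r * a * n \<or> p = s * a * n" "z = i + p" by blast
        then show ?thesis using \<tau>2[of i p] \<sigma> by (metis mem_Times_iff)
      next
        case 3
        then show ?thesis using w0 by (simp add: \<tau>_def)
      qed
    qed
    then obtain x where x: "x \<in> X" "\<forall>z\<in>J. x \<in> visits T A z (\<tau> z)" using shatteredD[OF J] by meson
    have "x \<in> visits T (?A (a * n)) i (\<sigma> i)" if i: "i \<in> S" for i
    proof -
      have mem: "(T ^^ z) x \<in> A (\<tau> z)" if "z \<in> J" for z using x(2) that by (simp add: visits_def)
      have "(T ^^ i) x \<in> A (fst (\<sigma> i))" using mem[of i] S(1) i \<tau>1[OF i] by (simp add: subsetD)
      moreover have "(T ^^ p) ((T ^^ i) x) \<in> A (snd (\<sigma> i))" if p: "p = r * a * n \<or> p = s * a * n" for p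
      proof -
        have "i + p \<in> J" using p S(2) i by blast
        moreover have "(T ^^ (i + p)) x = (T ^^ p) ((T ^^ i) x)" by (simp only: add.commute[of i p] funpow_add o_apply)
        ultimately show ?thesis using mem[of "i + p"] \<tau>2[OF i p] by simp
      qed
      then have "(T ^^ (r * a * n)) ((T ^^ i) x) \<in> A (snd (\<sigma> i))" "(T ^^ (s * a * n)) ((T ^^ i) x) \<in> A (snd (\<sigma> i))"
        by blast+
      ultimately show ?thesis by (simp add: visits_def case_prod_beta mult.assoc)
    qed
    then show "\<exists>x\<in>X. \<forall>z\<in>S. x \<in> visits T (?A (a * n)) z (\<sigma> z)" using x(1) by blast
  qed
  have "\<exists>\<^sub>F N in sequentially. \<exists>n\<in>{1..L}. \<exists>S\<subseteq>{..<N}. c' * real N \<le> real (card S) \<and>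
      shattered (visits T (?A (a * n))) (W \<times> W) X S"
  proof (rule frequently_rev_mp[OF freq], rule eventually_mono[OF eventually_ge_at_top[of N0]], rule impI)
    fix N assume N: "N0 \<le> N" and "\<exists>J\<subseteq>{..<N}. c * real N \<le> real (card J) \<and> shattered (visits T A) W X J"
    then obtain J where J: "J \<subseteq> {..<N}" "c * real N \<le> real (card J)" "shattered (visits T A) W X J" by blast
    then obtain n S where nS: "1 \<le> n" "n \<le> L" "S \<subseteq> J" "c' * real N \<le> real (card S)"
       "\<forall>i\<in>S. i + r * a * n \<in> J \<and> i + s * a * n \<in> J"
       "\<forall>i\<in>S. \<forall>j\<in>S. i mod (r * a * n + s * a * n + 1) = j mod (r * a * n + s * a * n + 1)"
      using conf[rule_format, OF N J(1,2)] by (elim exE conjE)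
    have "shattered (visits T (?A (a * n))) (W \<times> W) X S" by (rule sh[OF J(3) nS(1,3,5,6)])
    then show "\<exists>n\<in>{1..L}. \<exists>S\<subseteq>{..<N}. c' * real N \<le> real (card S) \<and>
      shattered (visits T (?A (a * n))) (W \<times> W) X S"
      using nS J(1) by (intro bexI[of _ n] exI[of _ S]) auto
  qed
  \<comment> \<open>The bound \<open>L\<close> does not depend on \<open>N\<close>, so one step
    \<open>n\<close> serves infinitely many \<open>N\<close>.\<close>
  then have "\<exists>n\<in>{1..L}. \<exists>\<^sub>F N in sequentially. \<exists>S\<subseteq>{..<N}. c' * real N \<le> real (card S) \<and>
      shattered (visits T (?A (a * n))) (W \<times> W) X S"
    by (rule frequently_bex_finite[OF finite_atLeastAtMost])
  then obtain n where n: "n \<in> {1..L}" and fr: "\<exists>\<^sub>F N in sequentially. \<exists>S\<subseteq>{..<N}. c' * real N \<le> real (card S) \<and>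
      shattered (visits T (?A (a * n))) (W \<times> W) X S" ..
  have "n0 \<le> a * n" using a n by (metis atLeastAtMost_iff le_trans mult_le_mono2 nat_mult_1_right)
  moreover have "dense_indep X T (?A (a * n)) (W \<times> W)" unfolding dense_indep_def using c' fr by blast
  ultimately show ?thesis by blast
qed

section \<open>From positive entropy to a separated pair of closed sets\<close>

lemma cover_number_le:
  assumes "\<V> \<subseteq> \<U>" "finite \<V>" "X \<subseteq> \<Union>\<V>"
  shows "cover_number X \<U> \<le> card \<V>"
  unfolding cover_number_def by (rule Least_le) (use assms in blast)

text \<open>
  Existence of the limit in \<open>cover_entropy\<close> is not needed: without exponential growth along some
  subsequence the limit exists and is \<open>0\<close>.
\<close>

lemma frequently_cover_number_ge:
  assumes "cover_entropy X T \<U> > 0"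
  shows "\<exists>c>0. \<exists>\<^sub>F n in sequentially. c * real n \<le> ln (real (cover_number X (iterated_join X T \<U> n)))"
proof (rule ccontr)
  define a where "a n = ln (real (cover_number X (iterated_join X T \<U> n))) / real n" for n
  have a_nonneg: "a n \<ge> 0" for n
    by (cases "cover_number X (iterated_join X T \<U> n) = 0") (auto simp: a_def)
  assume none: "\<not> ?thesis"
  have "a \<longlonglongrightarrow> 0"
  proof (rule tendstoI)
    fix e :: real assume e: "e > 0"
    then have "\<not> (\<exists>\<^sub>F n in sequentially. e * real n \<le> ln (real (cover_number X (iterated_join X T \<U> n))))"
      using none by blast
    then have "\<forall>\<^sub>F n in sequentially. \<not> e * real n \<le> ln (real (cover_number X (iterated_join X T \<U> n)))"
      by (simp add: not_frequently)
    then show "\<forall>\<^sub>F n in sequentially. dist (a n) 0 < e"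
      using eventually_gt_at_top[of 0]
    proof eventually_elim
      case (elim n)
      then have "a n < e" unfolding a_def by (simp add: divide_less_eq not_le)
      then show ?case using a_nonneg[of n] by (simp add: dist_real_def)
    qed
  qed
  then have "lim a = 0" by (rule limI)
  then show False using assms by (simp add: cover_entropy_def a_def[abs_def])
qed

text \<open>Take a finite subcover \<open>D\<close> of a cover with positive entropy and shrink each
  \<open>U\<close> in \<open>D\<close> to \<open>V U\<close>, with the sets \<open>V U\<close> still
  covering \<open>X\<close>. The covers by \<open>U\<close> and \<open>X - V U\<close>, for all
  \<open>U\<close> in \<open>D\<close>, have a common refinement that refines \<open>D\<close>. If
  none of them grew exponentially, neither would the joins of the cover.\<close>

lemma positive_entropy_imp_exp_cover_pair:
  fixes X :: "'a::metric_space set"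
  assumes sys: "dynamical_system X T" and ent: "topological_entropy X T > 0"
  shows "\<exists>A \<epsilon>. \<epsilon> > 0 \<and> (\<forall>b. closed (A b) \<and> A b \<subseteq> X) \<and> (\<forall>x\<in>A True. \<forall>y\<in>A False. \<epsilon> \<le> dist x y) \<and>
    exp_cover X T A (UNIV :: bool set)"
proof -
  have X: "compact X" and TX: "T ` X \<subseteq> X" using sys by (auto simp: dynamical_system_def)
  have TX': "(T ^^ n) x \<in> X" if "x \<in> X" for x n
    using that TX by (induction n) auto
  obtain \<U> where \<U>: "open_cover_of X \<U>" "cover_entropy X T \<U> > 0"
    using ent unfolding topological_entropy_def less_SUP_iff by (auto simp: zero_ereal_def)
  then obtain c where c: "c > 0"
    and freq: "\<exists>\<^sub>F n in sequentially. c * real n \<le> ln (real (cover_number X (iterated_join X T \<U> n)))"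
    using frequently_cover_number_ge by blast
  have ne: "X \<noteq> {}"
  proof
    assume "X = {}"
    then have "cover_number X (iterated_join X T \<U> n) = 0" for n
      using cover_number_le[of "{}" "iterated_join X T \<U> n" X] by simp
    then have "\<exists>\<^sub>F n in sequentially. c * real n \<le> 0" using freq by simp
    then have "\<exists>\<^sub>F n in sequentially. False"
      by (rule frequently_rev_mp) (use c in \<open>auto simp: mult_le_0_iff eventually_sequentially intro!: exI[of _ 1]\<close>)
    then show False by simp
  qed
  have "\<forall>U\<in>\<U>. openin (top_of_set X) U" "X \<subseteq> \<Union>\<U>" using \<U>(1) by (auto simp: open_cover_of_def)
  then obtain D where D: "D \<subseteq> \<U>" "finite D" "X \<subseteq> \<Union>D"
    using X unfolding compact_eq_openin_cover by meson
  have Dopen: "openin (top_of_set X) U" if "U \<in> D" for U using that D(1) \<U>(1) by (auto simp: open_cover_of_def)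
  have Gcov: "X \<subseteq> \<Union>{G. open G \<and> X \<inter> G \<in> D}"
  proof
    fix x assume "x \<in> X"
    then obtain U where "U \<in> D" "x \<in> U" using D by blast
    moreover from this obtain G where "open G" "U = X \<inter> G" using Dopen openin_open by metis
    ultimately show "x \<in> \<Union>{G. open G \<and> X \<inter> G \<in> D}" by blast
  qed
  have "\<exists>\<epsilon>>0. \<forall>x\<in>X. \<exists>G\<in>{G. open G \<and> X \<inter> G \<in> D}. ball x \<epsilon> \<subseteq> G"
    by (rule Heine_Borel_lemma[OF X Gcov]) blast+
  then obtain \<epsilon> where \<epsilon>: "\<epsilon> > 0" "\<And>x. x \<in> X \<Longrightarrow> \<exists>G\<in>{G. open G \<and> X \<inter> G \<in> D}. ball x \<epsilon> \<subseteq> G"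
    by blast
  \<comment> \<open>\<open>\<epsilon>\<close> is a Lebesgue number of \<open>D\<close>, so every
    point of \<open>X\<close> lies in some \<open>V U\<close>, and \<open>V U\<close> has distance
    at least \<open>\<epsilon>\<close> from \<open>X - U\<close>.\<close>
  define V where "V U = {x \<in> X. \<forall>y\<in>X - U. \<epsilon> \<le> dist x y}" for U
  define A where "A U b = (if b then V U else X - U)" for U b
  have V_cover: "\<exists>U\<in>D. x \<in> V U" if x: "x \<in> X" for x
  proof -
    obtain G where G: "X \<inter> G \<in> D" "ball x \<epsilon> \<subseteq> G" using \<epsilon>(2)[OF x] by blast
    have "\<epsilon> \<le> dist x y" if "y \<in> X - X \<inter> G" for y
    proof (rule ccontr)
      assume "\<not> \<epsilon> \<le> dist x y"
      then have "y \<in> ball x \<epsilon>" by simp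
      then show False using G(2) that by blast
    qed
    then have "x \<in> V (X \<inter> G)" using x by (simp add: V_def)
    then show ?thesis using G(1) by blast
  qed
  have Xc: "closed X" using X by (rule compact_imp_closed)
  have closed: "closed (A U b)" if UD: "U \<in> D" for U b
  proof -
    have "V U = X \<inter> (\<Inter>y\<in>X - U. {x. \<epsilon> \<le> dist x y})" by (auto simp: V_def)
    moreover have "closed (X \<inter> (\<Inter>y\<in>X - U. {x. \<epsilon> \<le> dist x y}))"
      by (intro closed_Int Xc closed_INT ballI closed_Collect_le continuous_intros)
    moreover obtain G where "open G" "U = X \<inter> G" using Dopen[OF UD] openin_open by metis
    then have "closed (X - U)" using Xc by (simp add: Diff_Int closed_Diff)
    ultimately show ?thesis by (simp add: A_def)
  qed
  \<comment> \<open>With this \<open>q\<close> the \<open>card D\<close> covers together grow at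
    rate at most \<open>c / 2\<close>, strictly below \<open>c\<close>.\<close>
  define q where "q = 2 * (real (card D) + 1)"
  have q: "q > 0" by (simp add: q_def)
  define \<theta> where "\<theta> = exp (c / q)"
  have \<theta>: "\<theta> > 1" using c q by (simp add: \<theta>_def)
  have bound: "cover_number X (iterated_join X T \<U> n) \<le> (\<theta> ^ n) ^ card D"
    if av: "\<And>U. U \<in> D \<Longrightarrow> avoidable (visits T (A U)) UNIV X {..<n} (\<theta> ^ n)" for n
  proof -
    obtain U0 where U0: "U0 \<in> D" using ne D(3) by blast
    \<comment> \<open>The point lies in some \<open>V U\<close> at time \<open>z\<close>, so
      \<open>h\<close> is \<open>False\<close> somewhere. Wherever \<open>h U\<close> is
      \<open>False\<close> the point avoids \<open>X - U\<close>, that is, it lies in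
      \<open>U\<close>; \<open>g\<close> selects such a \<open>U\<close>.\<close>
    define g where "g h = (if \<exists>U\<in>D. \<not> h U then SOME U. U \<in> D \<and> \<not> h U else U0)" for h
    have g: "g h \<in> D \<and> ((\<exists>U\<in>D. \<not> h U) \<longrightarrow> \<not> h (g h))" for h
    proof (cases "\<exists>U\<in>D. \<not> h U")
      case True
      then have "(SOME U. U \<in> D \<and> \<not> h U) \<in> D \<and> \<not> h (SOME U. U \<in> D \<and> \<not> h U)"
        using someI_ex[of "\<lambda>U. U \<in> D \<and> \<not> h U"] by blast
      then show ?thesis using True by (simp add: g_def)
    qed (use U0 in \<open>auto simp: g_def\<close>)
    have "avoidable (\<lambda>z U. {x. (T ^^ z) x \<notin> U}) D X {..<n} ((\<theta> ^ n) ^ card D)"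
    proof (rule avoidable_product[OF D(2), where g = g])
      show "avoidable (visits T (A U)) UNIV X {..<n} (\<theta> ^ n)" if "U \<in> D" for U by (rule av[OF that])
      show "g h \<in> D" for h using g by blast
      show "x \<notin> {x. (T ^^ z) x \<notin> g h}" if x: "x \<in> X" and *: "\<And>U. U \<in> D \<Longrightarrow> x \<notin> visits T (A U) z (h U)" for h x z
      proof -
        obtain U where U: "U \<in> D" "(T ^^ z) x \<in> V U" using V_cover[OF TX'[OF x]] by blast
        then have "\<not> h U" using *[OF U(1)] by (auto simp: visits_def A_def)
        then have gh: "g h \<in> D" "\<not> h (g h)" using g U(1) by blast+
        then show ?thesis using *[OF gh(1)] TX'[OF x] by (auto simp: visits_def A_def)
      qed
    qed
    then obtain B where B: "finite B" "real (card B) \<le> (\<theta> ^ n) ^ card D"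
      "\<And>b z. b \<in> B \<Longrightarrow> z \<in> {..<n} \<Longrightarrow> b z \<in> D"
      "\<And>x. x \<in> X \<Longrightarrow> \<exists>b\<in>B. \<forall>z\<in>{..<n}. x \<notin> {x. (T ^^ z) x \<notin> b z}"
      unfolding avoidable_def by blast
    define \<V> where "\<V> = (\<lambda>b. {x \<in> X. \<forall>i<n. (T ^^ i) x \<in> b i}) ` B"
    have "\<V> \<subseteq> iterated_join X T \<U> n"
    proof
      fix S assume "S \<in> \<V>"
      then obtain b where b: "b \<in> B" "S = {x \<in> X. \<forall>i<n. (T ^^ i) x \<in> b i}" by (auto simp: \<V>_def)
      have "b i \<in> \<U>" if "i < n" for i using B(3)[OF b(1), of i] D(1) that by auto
      then show "S \<in> iterated_join X T \<U> n"
        unfolding iterated_join_def b(2) by (intro CollectI exI[of _ b] conjI refl) blast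
    qed
    moreover have "finite \<V>" using B(1) by (simp add: \<V>_def)
    moreover have "X \<subseteq> \<Union>\<V>"
    proof
      fix x assume x: "x \<in> X"
      then obtain b where "b \<in> B" "\<forall>i<n. (T ^^ i) x \<in> b i" using B(4)[OF x] by auto
      then show "x \<in> \<Union>\<V>" using x by (auto simp: \<V>_def)
    qed
    ultimately have "cover_number X (iterated_join X T \<U> n) \<le> card \<V>" by (rule cover_number_le)
    also have "card \<V> \<le> card B" unfolding \<V>_def by (rule card_image_le[OF B(1)])
    finally show ?thesis using B(2) by linarith
  qed
  have "\<exists>\<^sub>F n in sequentially. \<exists>U\<in>D. \<not> avoidable (visits T (A U)) UNIV X {..<n} (\<theta> ^ n)"
  proof (rule frequently_rev_mp[OF freq], rule eventually_mono[OF eventually_ge_at_top[of 1]], rule impI, rule ccontr)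
    fix n assume n: "1 \<le> n" and ge: "c * real n \<le> ln (real (cover_number X (iterated_join X T \<U> n)))"
      and "\<not> (\<exists>U\<in>D. \<not> avoidable (visits T (A U)) UNIV X {..<n} (\<theta> ^ n))"
    then have le: "real (cover_number X (iterated_join X T \<U> n)) \<le> (\<theta> ^ n) ^ card D" using bound by blast
    have cn: "c * real n > 0" using c n by simp
    have "real (cover_number X (iterated_join X T \<U> n)) > 0"
    proof (rule ccontr)
      assume "\<not> ?thesis"
      then have "cover_number X (iterated_join X T \<U> n) = 0" by simp
      then show False using ge cn by simp
    qed
    then have "ln (real (cover_number X (iterated_join X T \<U> n))) \<le> ln ((\<theta> ^ n) ^ card D)"
      using le by (subst ln_le_cancel_iff) (auto simp: \<theta>_def)
    also have "\<dots> = c * real n * (real (card D) / q)"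
      by (simp add: \<theta>_def flip: exp_of_nat_mult power_mult)
    also have "\<dots> < c * real n * 1"
      using cn by (intro mult_strict_left_mono) (auto simp: q_def divide_less_eq)
    finally show False using ge by simp
  qed
  from frequently_bex_finite[OF D(2) this] obtain U where U: "U \<in> D"
    and fr: "\<exists>\<^sub>F n in sequentially. \<not> avoidable (visits T (A U)) UNIV X {..<n} (\<theta> ^ n)" ..
  have "exp_cover X T (A U) UNIV" unfolding exp_cover_def using \<theta> fr by blast
  moreover have "\<forall>b. closed (A U b) \<and> A U b \<subseteq> X" using closed[OF U] by (auto simp: A_def V_def)
  moreover have "\<forall>x\<in>A U True. \<forall>y\<in>A U False. \<epsilon> \<le> dist x y" by (simp add: A_def V_def)
  ultimately show ?thesis using \<epsilon>(1) by blast
qed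

subsection \<open>The scrambled set\<close>

lemma finite_words: "finite {w :: bool list. length w = m}"
  using finite_lists_length_eq[of "UNIV :: bool set" m] by simp

lemma card_words: "card {w :: bool list. length w = m} = 2 ^ m"
  using card_lists_length_eq[of "UNIV :: bool set" m] by (simp add: card_UNIV_bool)

text \<open>Closedness yields a point for every infinite code by compactness. Disjointness separates
  the points of different codes and permits the return from \<open>exp_cover\<close> to
  \<open>dense_indep\<close>.\<close>

definition cell_system :: "'a::metric_space set \<Rightarrow> ('a \<Rightarrow> 'a) \<Rightarrow> (bool \<Rightarrow> 'a set) \<Rightarrow> nat \<Rightarrow> (bool list \<Rightarrow> 'a set) \<Rightarrow> bool" where
  "cell_system X T A m B \<longleftrightarrow>
     (\<forall>w. length w = m \<longrightarrow> closed (B w) \<and> B w \<subseteq> X \<and> B w \<subseteq> A (hd w)) \<and>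
     (\<forall>v w. length v = m \<longrightarrow> length w = m \<longrightarrow> v \<noteq> w \<longrightarrow> B v \<inter> B w = {}) \<and>
     dense_indep X T B {w. length w = m}"

text \<open>The second clause ranges over all pairs of words, so it gives closeness for every pair
  of codes and in both orders. The third places one point in the same \<open>A a\<close> at both
  times; two points with different last letters are then far apart, again in both orders.\<close>

definition scrambling_step ::
    "nat \<Rightarrow> nat \<Rightarrow> ('a::metric_space \<Rightarrow> 'a) \<Rightarrow> (bool \<Rightarrow> 'a set) \<Rightarrow> nat \<Rightarrow> (bool list \<Rightarrow> 'a set) \<Rightarrow> (bool list \<Rightarrow> 'a set) \<Rightarrow> bool" where
  "scrambling_step r s T A m B B' \<longleftrightarrow>
     (\<forall>w a. length w = m \<longrightarrow> B' (w @ [a]) \<subseteq> B w) \<and>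
     (\<exists>n\<ge>m. \<forall>v w x y. length v = Suc m \<longrightarrow> length w = Suc m \<longrightarrow> x \<in> B' v \<longrightarrow> y \<in> B' w \<longrightarrow>
        dist ((T ^^ (r * n)) x) ((T ^^ (s * n)) y) < 1 / real m) \<and>
     (\<exists>n\<ge>m. \<forall>w a x. length w = m \<longrightarrow> x \<in> B' (w @ [a]) \<longrightarrow>
        (T ^^ (r * n)) x \<in> A a \<and> (T ^^ (s * n)) x \<in> A a)"

lemma dense_indep_nonempty:
  assumes "dense_indep X T A W" "w \<in> W"
  shows "A w \<noteq> {}"
proof -
  obtain c where c: "c > 0" and freq: "\<exists>\<^sub>F N in sequentially. \<exists>J\<subseteq>{..<N}. c * real N \<le> real (card J) \<and> shattered (visits T A) W X J"
    using assms(1) unfolding dense_indep_def by blast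
  have "\<exists>\<^sub>F N in sequentially. A w \<noteq> {}"
  proof (rule frequently_rev_mp[OF freq], rule eventually_mono[OF eventually_ge_at_top[of 1]], rule impI)
    fix N assume N: "1 \<le> N" and "\<exists>J\<subseteq>{..<N}. c * real N \<le> real (card J) \<and> shattered (visits T A) W X J"
    then obtain J where J: "c * real N \<le> real (card J)" "shattered (visits T A) W X J" by blast
    have "c * real N > 0" using c N by simp
    then have "J \<noteq> {}" using J(1) by auto
    then obtain j where j: "j \<in> J" by blast
    have "\<exists>x\<in>X. \<forall>z\<in>J. x \<in> visits T A z w" by (rule shatteredD[OF J(2)]) (rule assms(2))
    then show "A w \<noteq> {}" using j by (auto simp: visits_def)
  qed
  then show ?thesis by simp
qed

lemma continuous_on_funpow_self:
  assumes "continuous_on X T" "T ` X \<subseteq> X"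
  shows "continuous_on X (T ^^ n) \<and> (T ^^ n) ` X \<subseteq> X"
proof (induction n)
  case (Suc n)
  then have "continuous_on X (T \<circ> (T ^^ n))"
    using assms by (intro continuous_on_compose) (auto intro: continuous_on_subset)
  moreover have "(T \<circ> (T ^^ n)) ` X \<subseteq> X" using Suc assms(2) by fastforce
  ultimately show ?case by simp
qed simp

lemma closed_return_set:
  assumes "compact X" "continuous_on X T" "T ` X \<subseteq> X" "closed B" "B \<subseteq> X" "closed C"
  shows "closed {x \<in> B. (T ^^ n) x \<in> C \<and> (T ^^ n') x \<in> C}"
proof -
  have "continuous_on B (T ^^ i)" for i
    using continuous_on_funpow_self[OF assms(2,3), of i] assms(5) continuous_on_subset by blast
  then have cl: "closed (B \<inter> (T ^^ i) -` C)" for i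
    using assms(4,6) by (intro continuous_closed_preimage)
  have "closed ((B \<inter> (T ^^ n) -` C) \<inter> (B \<inter> (T ^^ n') -` C))" by (rule closed_Int[OF cl cl])
  moreover have "(B \<inter> (T ^^ n) -` C) \<inter> (B \<inter> (T ^^ n') -` C) = {x \<in> B. (T ^^ n) x \<in> C \<and> (T ^^ n') x \<in> C}" by auto
  ultimately show ?thesis by simp
qed

text \<open>One shrinking and two returns. After the shrinking, the first return brings all cells
  into the small cell and keeps the words; the second appends a letter by choosing the cell to
  return to.\<close>

lemma cell_system_step:
  assumes sys: "compact X" "continuous_on X T" "T ` X \<subseteq> X" and rs: "1 \<le> r" "1 \<le> s"
    and A: "A True \<inter> A False = {}" and m: "m \<ge> 1" and B: "cell_system X T A m B"
  shows "\<exists>B'. cell_system X T A (Suc m) B' \<and> scrambling_step r s T A m B B'"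
proof -
  let ?W = "{w :: bool list. length w = m}"
  have cW: "card ?W \<ge> 2" using m card_words[of m] self_le_power[of 2 m] by simp
  have B_closed: "closed (B w)" and B_X: "B w \<subseteq> X" and B_A: "B w \<subseteq> A (hd w)" if "length w = m" for w
    using B that by (auto simp: cell_system_def)
  have B_disj: "B v \<inter> B w = {}" if "length v = m" "length w = m" "v \<noteq> w" for v w
    using B that by (simp add: cell_system_def)
  have B_ind: "dense_indep X T B ?W" using B by (simp add: cell_system_def)
  define u0 where "u0 = replicate m False"
  have u0: "length u0 = m" by (simp add: u0_def)
  \<comment> \<open>Two points of a closed ball of radius \<open>1 / (3 * m)\<close> have distance
    at most \<open>2 / (3 * m)\<close>, strictly below \<open>1 / m\<close>.\<close>
  obtain K where K: "finite K" "K \<subseteq> X" "X \<subseteq> (\<Union>k\<in>K. ball k (1 / (3 * real m)))"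
  proof -
    have "X \<subseteq> (\<Union>k\<in>X. ball k (1 / (3 * real m)))" using m by auto
    then show ?thesis by (rule compactE_image[OF sys(1) open_ball]) (use that in blast)
  qed
  have "B u0 \<subseteq> (\<Union>k\<in>K. B u0 \<inter> cball k (1 / (3 * real m)))"
  proof
    fix x assume x: "x \<in> B u0"
    then have "x \<in> X" using B_X[OF u0] by blast
    then obtain k where "k \<in> K" "x \<in> ball k (1 / (3 * real m))" using K(3) by blast
    then show "x \<in> (\<Union>k\<in>K. B u0 \<inter> cball k (1 / (3 * real m)))"
      using x ball_subset_cball by blast
  qed
  then obtain k where "exp_cover X T (B(u0 := B u0 \<inter> cball k (1 / (3 * real m)))) ?W"
    using exp_cover_shrink[OF dense_indep_imp_exp_cover[OF B_ind finite_words cW] _ K(1), of u0] u0 by blast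
  moreover define B1 where "B1 = B(u0 := B u0 \<inter> cball k (1 / (3 * real m)))"
  ultimately have B1_exp: "exp_cover X T B1 ?W" by simp
  have B1_B: "B1 w \<subseteq> B w" for w by (auto simp: B1_def)
  have B1_closed: "closed (B1 w)" if "length w = m" for w
    using B_closed[OF that] by (auto simp: B1_def)
  have B1_small: "dist p q < 1 / real m" if "p \<in> B1 u0" "q \<in> B1 u0" for p q
  proof -
    have "dist k p \<le> 1 / (3 * real m)" "dist k q \<le> 1 / (3 * real m)" using that by (auto simp: B1_def)
    then have "dist p q \<le> 1 / (3 * real m) + 1 / (3 * real m)" using dist_triangle3[of p q k] by linarith
    also have "\<dots> < 1 / real m" using m by (simp add: field_simps)
    finally show ?thesis .
  qed
  have B1_ind: "dense_indep X T B1 ?W"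
    by (rule exp_cover_imp_dense_indep[OF B1_exp finite_words cW]) (use B_disj B1_B in blast)
  have W_ne: "?W \<noteq> {}" using u0 by blast
  obtain n1 where n1: "n1 \<ge> m" and
    ind1: "dense_indep X T (\<lambda>(w, u). {x \<in> B1 w. (T ^^ (r * n1)) x \<in> B1 u \<and> (T ^^ (s * n1)) x \<in> B1 u}) (?W \<times> ?W)"
    using dense_indep_return[OF B1_ind rs W_ne, of m] by blast
  define B2 where "B2 w = {x \<in> B1 w. (T ^^ (r * n1)) x \<in> B1 u0 \<and> (T ^^ (s * n1)) x \<in> B1 u0}" for w
  have B2_ind: "dense_indep X T B2 ?W"
    by (rule dense_indep_reindex[OF ind1, where f = "\<lambda>w. (w, u0)"]) (auto simp: u0 B2_def)
  have B2_B: "B2 w \<subseteq> B w" for w using B1_B by (auto simp: B2_def)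
  have B2_closed: "closed (B2 w)" if "length w = m" for w
    unfolding B2_def using B1_closed[OF that] B1_closed[OF u0] B1_B[of w] B_X[OF that]
    by (intro closed_return_set[OF sys]) auto
  obtain n2 where n2: "n2 \<ge> m" and
    ind2: "dense_indep X T (\<lambda>(w, u). {x \<in> B2 w. (T ^^ (r * n2)) x \<in> B2 u \<and> (T ^^ (s * n2)) x \<in> B2 u}) (?W \<times> ?W)"
    using dense_indep_return[OF B2_ind rs W_ne, of m] by blast
  \<comment> \<open>A word of length \<open>m\<close> with first letter \<open>a\<close>, so that
    its cell lies in \<open>A a\<close>. Returning to the disjoint sets \<open>A True\<close> and
    \<open>A False\<close> also separates the two new cells inside one old cell.\<close>
  define u where "u a = a # replicate (m - 1) False" for a
  have u: "length (u a) = m" for a using m by (simp add: u_def)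
  have u_A: "B2 (u a) \<subseteq> A a" for a using B2_B[of "u a"] B_A[OF u[of a]] by (auto simp: u_def)
  define B' where "B' v = {x \<in> B2 (butlast v). (T ^^ (r * n2)) x \<in> B2 (u (last v)) \<and> (T ^^ (s * n2)) x \<in> B2 (u (last v))}" for v
  have "cell_system X T A (Suc m) B'"
    unfolding cell_system_def
  proof (intro conjI allI impI)
    fix v :: "bool list" assume v: "length v = Suc m"
    then have bl: "length (butlast v) = m" by simp
    show "closed (B' v)"
      unfolding B'_def using B2_closed[OF bl] B2_closed[OF u] B2_B[of "butlast v"] B_X[OF bl]
      by (intro closed_return_set[OF sys]) auto
    show "B' v \<subseteq> X" using B2_B[of "butlast v"] B_X[OF bl] by (auto simp: B'_def)
    have "butlast v \<noteq> []" using bl m by (metis list.size(3) not_one_le_zero)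
    then have "hd (butlast v) = hd v" by (metis append_butlast_last_id butlast.simps(1) hd_append2)
    then show "B' v \<subseteq> A (hd v)" using B2_B[of "butlast v"] B_A[OF bl] by (auto simp: B'_def)
  next
    fix v w :: "bool list" assume vw: "length v = Suc m" "length w = Suc m" "v \<noteq> w"
    show "B' v \<inter> B' w = {}"
    proof (cases "butlast v = butlast w")
      case True
      have "v \<noteq> []" "w \<noteq> []" using vw by auto
      then have "butlast v @ [last v] \<noteq> butlast w @ [last w]" using vw(3) by simp
      then have "last v \<noteq> last w" using True by simp
      then have "A (last v) \<inter> A (last w) = {}" using A by (cases "last v"; cases "last w") auto
      then show ?thesis using u_A unfolding B'_def by blast
    next
      case False
      then have "B (butlast v) \<inter> B (butlast w) = {}" using vw by (intro B_disj) auto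
      then show ?thesis using B2_B unfolding B'_def by blast
    qed
  next
    show "dense_indep X T B' {w. length w = Suc m}"
      by (rule dense_indep_reindex[OF ind2, where f = "\<lambda>v. (butlast v, u (last v))"]) (auto simp: u B'_def)
  qed
  moreover have "scrambling_step r s T A m B B'"
    unfolding scrambling_step_def
  proof (intro conjI)
    show "\<forall>w a. length w = m \<longrightarrow> B' (w @ [a]) \<subseteq> B w" using B2_B by (auto simp: B'_def)
    have "dist ((T ^^ (r * n1)) x) ((T ^^ (s * n1)) y) < 1 / real m" if "x \<in> B' v" "y \<in> B' w" for v w x y
      using that by (intro B1_small) (auto simp: B'_def B2_def)
    then show "\<exists>n\<ge>m. \<forall>v w x y. length v = Suc m \<longrightarrow> length w = Suc m \<longrightarrow> x \<in> B' v \<longrightarrow> y \<in> B' w \<longrightarrow>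
        dist ((T ^^ (r * n)) x) ((T ^^ (s * n)) y) < 1 / real m"
      using n1 by (intro exI[of _ n1]) simp
    show "\<exists>n\<ge>m. \<forall>w a x. length w = m \<longrightarrow> x \<in> B' (w @ [a]) \<longrightarrow>
        (T ^^ (r * n)) x \<in> A a \<and> (T ^^ (s * n)) x \<in> A a"
      using n2 u_A by (intro exI[of _ n2]) (auto simp: B'_def)
  qed
  ultimately show ?thesis by blast
qed

lemma scrambled_pairI:
  assumes close: "\<And>m. m \<ge> 1 \<Longrightarrow> \<exists>n\<ge>m. dist ((T ^^ (r * n)) x) ((T ^^ (s * n)) y) < 1 / real m"
    and far: "\<epsilon> > 0" "\<And>m. \<exists>n\<ge>m. \<epsilon> \<le> dist ((T ^^ (r * n)) x) ((T ^^ (s * n)) y)"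
  shows "scrambled_pair r s T x y"
proof -
  define a where "a n = dist ((T ^^ (r * n)) x) ((T ^^ (s * n)) y)" for n
  have "0 \<le> liminf (\<lambda>n. ereal (a n))" by (rule Liminf_bounded) (simp add: a_def)
  moreover have "liminf (\<lambda>n. ereal (a n)) \<le> 0"
  proof (rule ccontr)
    assume "\<not> ?thesis"
    then have "0 < liminf (\<lambda>n. ereal (a n))" by simp
    then obtain e where e: "0 < ereal e" "ereal e < liminf (\<lambda>n. ereal (a n))"
      using ereal_dense2 by blast
    have "\<forall>\<^sub>F n in sequentially. ereal e < ereal (a n)" by (rule less_LiminfD[OF e(2)])
    then obtain N where N: "\<And>n. n \<ge> N \<Longrightarrow> e < a n" by (auto simp: eventually_sequentially)
    obtain m0 :: nat where m0: "real m0 > 1 / e" using reals_Archimedean2 by blast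
    define m where "m = max (max 1 N) m0"
    have "m \<ge> 1" by (simp add: m_def)
    then obtain n where n: "n \<ge> m" "a n < 1 / real m" using close[of m] unfolding a_def by blast
    have "real m \<ge> real m0" by (simp add: m_def)
    then have "real m > 1 / e" using m0 by linarith
    moreover have "e > 0" using e(1) by simp
    ultimately have "1 / real m < e" by (simp add: field_simps m_def)
    moreover have "e < a n" using N[of n] n(1) by (simp add: m_def)
    ultimately show False using n(2) by linarith
  qed
  ultimately have lim0: "liminf (\<lambda>n. ereal (a n)) = 0" by (intro antisym)
  have "ereal \<epsilon> \<le> limsup (\<lambda>n. ereal (a n))"
  proof (rule ccontr)
    assume "\<not> ?thesis"
    then have "\<forall>\<^sub>F n in sequentially. ereal (a n) < ereal \<epsilon>" by (intro Limsup_lessD) simp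
    then obtain N where "\<And>n. n \<ge> N \<Longrightarrow> a n < \<epsilon>" by (auto simp: eventually_sequentially)
    then show False using far(2)[of N] by (force simp: a_def)
  qed
  then have "0 < limsup (\<lambda>n. ereal (a n))" using far(1) by (meson ereal_less(2) less_le_trans)
  with lim0 show ?thesis unfolding scrambled_pair_def a_def by (rule conjI)
qed

lemma uncountable_nat_sets: "uncountable (UNIV :: nat set set)"
proof
  assume "countable (UNIV :: nat set set)"
  then have "surj (from_nat_into (UNIV :: nat set set))" by (simp add: range_from_nat_into)
  then show False using Cantors_theorem[of UNIV] by (metis Pow_UNIV)
qed

theorem theorem6p3:
  fixes X :: "'a::metric_space set" and T :: "'a \<Rightarrow> 'a" and r s :: nat
  assumes "dynamical_system X T"
    and "topological_entropy X T > 0"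
    and "r \<ge> 1" and "s \<ge> 1"
  shows "Li_Yorke_chaotic r s X T"
proof -
  have sys: "compact X" "continuous_on X T" "T ` X \<subseteq> X" using assms(1) by (auto simp: dynamical_system_def)
  obtain A \<epsilon> where \<epsilon>: "\<epsilon> > 0" and A: "\<And>b. closed (A b)" "\<And>b. A b \<subseteq> X" "\<And>x y. x \<in> A True \<Longrightarrow> y \<in> A False \<Longrightarrow> \<epsilon> \<le> dist x y"
    and A_exp: "exp_cover X T A (UNIV :: bool set)"
    using positive_entropy_imp_exp_cover_pair[OF assms(1,2)] by blast
  have A_far: "\<epsilon> \<le> dist x y" if "x \<in> A a" "y \<in> A b" "a \<noteq> b" for x y a b
    using that A(3)[of x y] A(3)[of y x] by (cases a; cases b) (auto simp: dist_commute)
  have A_disj: "A a \<inter> A b = {}" if "a \<noteq> b" for a b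
    using A_far[OF _ _ that] \<epsilon> by force
  have A_ind: "dense_indep X T A UNIV"
    by (rule exp_cover_imp_dense_indep[OF A_exp]) (use A_disj in \<open>auto simp: card_UNIV_bool\<close>)
  \<comment> \<open>Dependent choice of the levels. Level \<open>n\<close> carries words of length
    \<open>Suc n\<close>, since cells start from a first letter.\<close>
  have "\<exists>B. \<forall>n. cell_system X T A (Suc n) (B n) \<and> scrambling_step r s T A (Suc n) (B n) (B (Suc n))"
  proof (rule dependent_nat_choice)
    have "cell_system X T A (Suc 0) (\<lambda>w. A (hd w))"
      unfolding cell_system_def
    proof (intro conjI allI impI)
      fix v w :: "bool list" assume "length v = Suc 0" "length w = Suc 0" "v \<noteq> w"
      then have "hd v \<noteq> hd w" by (auto simp: length_Suc_conv)
      then show "A (hd v) \<inter> A (hd w) = {}" by (rule A_disj)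
    next
      show "dense_indep X T (\<lambda>w. A (hd w)) {w. length w = Suc 0}"
        by (rule dense_indep_reindex[OF A_ind, where f = hd]) auto
    qed (use A in auto)
    then show "\<exists>B. cell_system X T A (Suc 0) B" by blast
  next
    fix B n assume "cell_system X T A (Suc n) B"
    then show "\<exists>B'. cell_system X T A (Suc (Suc n)) B' \<and> scrambling_step r s T A (Suc n) B B'"
      using A_disj[of True False] by (intro cell_system_step[OF sys assms(3,4)]) auto
  qed
  then obtain B where B: "\<And>n. cell_system X T A (Suc n) (B n)"
    "\<And>n. scrambling_step r s T A (Suc n) (B n) (B (Suc n))" by blast
  define word :: "(nat \<Rightarrow> bool) \<Rightarrow> nat \<Rightarrow> bool list" where "word \<omega> n = map \<omega> [0..<Suc n]" for \<omega> n
  have len: "length (word \<omega> n) = Suc n" for \<omega> n by (simp add: word_def)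
  have word_Suc: "word \<omega> (Suc n) = word \<omega> n @ [\<omega> (Suc n)]" for \<omega> n by (simp add: word_def)
  have cell_closed: "closed (B n (word \<omega> n))" and cell_X: "B n (word \<omega> n) \<subseteq> X" for \<omega> n
    using B(1)[of n] len unfolding cell_system_def by blast+
  have cell_ne: "B n (word \<omega> n) \<noteq> {}" for \<omega> n
    by (rule dense_indep_nonempty[of X T "B n" "{w. length w = Suc n}"])
       (use B(1)[of n] len in \<open>auto simp: cell_system_def\<close>)
  have cell_dec: "B (Suc n) (word \<omega> (Suc n)) \<subseteq> B n (word \<omega> n)" for \<omega> n
    using B(2)[of n] len unfolding scrambling_step_def word_Suc by blast
  have "\<exists>x. x \<in> X \<and> (\<forall>n. x \<in> B n (word \<omega> n))" for \<omega>
  proof -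
    have dec: "B n (word \<omega> n) \<subseteq> B k (word \<omega> k)" if "k \<le> n" for k n
      using that by (rule lift_Suc_antimono_le[of "\<lambda>n. B n (word \<omega> n)", OF cell_dec])
    have "X \<inter> (\<Inter>n\<in>UNIV. B n (word \<omega> n)) \<noteq> {}"
    proof (rule compact_imp_fip_image[OF sys(1)])
      fix I :: "nat set" assume "finite I"
      then obtain N where N: "\<And>i. i \<in> I \<Longrightarrow> i \<le> N" by (metis finite_nat_set_iff_bounded_le)
      obtain x where "x \<in> B N (word \<omega> N)" using cell_ne by blast
      then have "x \<in> X \<inter> (\<Inter>n\<in>I. B n (word \<omega> n))" using dec N cell_X by blast
      then show "X \<inter> (\<Inter>n\<in>I. B n (word \<omega> n)) \<noteq> {}" by blast
    qed (rule cell_closed)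
    then show ?thesis by blast
  qed
  then obtain pt where pt: "\<And>\<omega>. pt \<omega> \<in> X" "\<And>\<omega> n. pt \<omega> \<in> B n (word \<omega> n)" by metis
  \<comment> \<open>Closeness comes from every level, separation from the levels where the codes
    differ. Passing from level \<open>k\<close> to \<open>Suc k\<close> appends the letter
    \<open>\<omega> (Suc k)\<close>, so codes are compared at positive indices.\<close>
  have scr: "scrambled_pair r s T (pt \<omega>) (pt \<omega>')" if inf: "\<And>m. \<exists>n\<ge>m. \<omega> (Suc n) \<noteq> \<omega>' (Suc n)" for \<omega> \<omega>'
  proof (rule scrambled_pairI[OF _ \<epsilon>])
    fix m :: nat assume m: "m \<ge> 1"
    then obtain k where k: "m = Suc k" by (cases m) auto
    obtain n where "n \<ge> m" "\<forall>v w x y. length v = Suc m \<longrightarrow> length w = Suc m \<longrightarrow> x \<in> B m v \<longrightarrow> y \<in> B m w \<longrightarrow>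
        dist ((T ^^ (r * n)) x) ((T ^^ (s * n)) y) < 1 / real m"
      using B(2)[of k] unfolding scrambling_step_def k by blast
    then show "\<exists>n\<ge>m. dist ((T ^^ (r * n)) (pt \<omega>)) ((T ^^ (s * n)) (pt \<omega>')) < 1 / real m"
      using pt(2) len by blast
  next
    fix m :: nat
    obtain k where k: "k \<ge> m" "\<omega> (Suc k) \<noteq> \<omega>' (Suc k)" using inf by blast
    obtain n where n: "n \<ge> Suc k" "\<forall>w a x. length w = Suc k \<longrightarrow> x \<in> B (Suc k) (w @ [a]) \<longrightarrow>
        (T ^^ (r * n)) x \<in> A a \<and> (T ^^ (s * n)) x \<in> A a"
      using B(2)[of k] unfolding scrambling_step_def by blast
    have in_A: "(T ^^ (r * n)) (pt \<eta>) \<in> A (\<eta> (Suc k)) \<and> (T ^^ (s * n)) (pt \<eta>) \<in> A (\<eta> (Suc k))" for \<eta>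
      using n(2) pt(2)[of \<eta> "Suc k"] len[of \<eta> k] unfolding word_Suc by blast
    have "\<epsilon> \<le> dist ((T ^^ (r * n)) (pt \<omega>)) ((T ^^ (s * n)) (pt \<omega>'))"
      using in_A[of \<omega>] in_A[of \<omega>'] k(2) A_far by blast
    then show "\<exists>n\<ge>m. \<epsilon> \<le> dist ((T ^^ (r * n)) (pt \<omega>)) ((T ^^ (s * n)) (pt \<omega>'))"
      using n(1) k(1) by (intro exI[of _ n]) simp
  qed
  \<comment> \<open>Membership of each \<open>i\<close> is recorded at all indices
    \<open>prod_encode (i, k)\<close>, so different sets have codes that differ infinitely
    often.\<close>
  define code :: "nat set \<Rightarrow> nat \<Rightarrow> bool" where "code S n \<longleftrightarrow> fst (prod_decode n) \<in> S" for S n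
  have code_inf: "\<exists>n\<ge>m. code S (Suc n) \<noteq> code S' (Suc n)" if "S \<noteq> S'" for S S' m
  proof -
    obtain i where i: "(i \<in> S) \<noteq> (i \<in> S')" using \<open>S \<noteq> S'\<close> by blast
    have "Suc m \<le> prod_encode (i, Suc m)" by (rule le_prod_encode_2)
    moreover have "code S (prod_encode (i, Suc m)) \<noteq> code S' (prod_encode (i, Suc m))" using i by (simp add: code_def)
    ultimately show ?thesis by (intro exI[of _ "prod_encode (i, Suc m) - 1"]) auto
  qed
  have inj: "inj (\<lambda>S. pt (code S))"
  proof (rule injI, rule ccontr)
    fix S S' assume eq: "pt (code S) = pt (code S')" and "S \<noteq> S'"
    then obtain n where "code S (Suc n) \<noteq> code S' (Suc n)" using code_inf by blast
    then have "word (code S) (Suc n) \<noteq> word (code S') (Suc n)" by (simp add: word_Suc)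
    then have "B (Suc n) (word (code S) (Suc n)) \<inter> B (Suc n) (word (code S') (Suc n)) = {}"
      using B(1)[of "Suc n"] len unfolding cell_system_def by blast
    then show False using pt(2)[of "code S" "Suc n"] pt(2)[of "code S'" "Suc n"] eq by auto
  qed
  have "scrambled_set r s X T (range (\<lambda>S. pt (code S)))"
    unfolding scrambled_set_def
  proof (intro conjI ballI impI)
    fix x y assume "x \<in> range (\<lambda>S. pt (code S))" "y \<in> range (\<lambda>S. pt (code S))" "x \<noteq> y"
    then obtain S S' where "x = pt (code S)" "y = pt (code S')" "S \<noteq> S'" by blast
    then show "scrambled_pair r s T x y" using code_inf by (auto intro!: scr)
  qed (use pt(1) in blast)
  moreover have "uncountable (range (\<lambda>S. pt (code S)))"
    using uncountable_nat_sets countable_image_inj_eq[OF inj] by blast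
  ultimately show ?thesis unfolding Li_Yorke_chaotic_def by blast
qed

end
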